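(* Let $(M,g)$ be an $n$-dimensional Riemannian manifold ($n\ge 3$), $(B,g_B)$ a Riemannian vector bundle over $M$ of rank $m-n$, and $\zeta$ a $B$-valued symmetric $(1,2)$-tensor field on $M$. Let $T$ be a curvature-like tensor field on $M$ satisfying the algebraic Gauss equation $$T(X,Y,Z,W)=g_B(\zeta(X,W),\zeta(Y,Z))-g_B(\zeta(X,Z),\zeta(Y,W))$$ for all vector fields $X,Y,Z,W$ on $M$. Then for every $p\in M$: $$(\tau_T)_{\rm Nor}(p)\le \frac{1}{n(n-1)}\,[\delta_{\mathcal C^{T,\zeta}}(r;n-1)]_p\qquad\text{for every real } r \text{ with } 0<r<n(n-1),\tag{i}$$ $$(\tau_T)_{\rm Nor}(p)\le \frac{1}{n(n-1)}\,[\widehat\delta_{\mathcal C^{T,\zeta}}(r;n-1)]_p\qquad\text{for every real } r \text{ with } n(n-1)<r.\tag{ii}$$ Moreover, if $\inf\{\mathcal C^{T,\zeta}(\Pi_{n-1}):\Pi_{n-1}\text{ is a hyperplane of }T_pM\}$ (respectively $\sup\{\mathcal C^{T,\zeta}(\Pi_{n-1}):\Pi_{n-1}\text{ is a hyperplane of }T_pM\}$) is attained by a hyperplane $\Pi_{n-1}$ of $T_pM$, $p\in M$, then equality holds in (i) (respectively in (ii)) at $p$ if and only if, with respect to a suitable orthonormal basis $\{e_1,\dots,e_n\}$ of $T_pM$ and a suitable orthonormal basis $\{e_{n+1},\dots,e_m\}$ of the fibre $B_p$, the components $\zeta_{ij}^\alpha=g_B(\zeta(e_i,e_j),e_\alpha)$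 satisfy $$\zeta_{ij}^\alpha=0\qquad (i,j\in\{1,\dots,n\},\ i\ne j,\ \alpha\in\{n+1,\dots,m\}),$$ $$\zeta_{11}^\alpha=\zeta_{22}^\alpha=\cdots=\zeta_{n-1\,n-1}^\alpha=\frac{r}{n(n-1)}\,\zeta_{nn}^\alpha\qquad(\alpha\in\{n+1,\dots,m\}).$$
   Context: A $B$-valued symmetric $(1,2)$-tensor field $\zeta$ on $M$ assigns to each $p$ a symmetric bilinear map $T_pM\times T_pM\to B_p$. A curvature-like tensor field is a $(0,4)$-tensor field $T$ with $T(X,Y,Z,W)=-T(Y,X,Z,W)$, $T(X,Y,Z,W)=T(Z,W,X,Y)$ and $T(X,Y,Z,W)+T(Y,Z,X,W)+T(Z,X,Y,W)=0$. The $T$-scalar curvature at $p$ is $\tau_T(p)=\sum_{1\le i<j\le n}T(e_i,e_j,e_j,e_i)$ for any orthonormal basis $\{e_1,\dots,e_n\}$ of $T_pM$, and the $T$-normalized scalar curvature is $(\tau_T)_{\rm Nor}(p)=\frac{2}{n(n-1)}\tau_T(p)$. For a $k$-dimensional subspace $\Pi_k\subset T_pM$, $k\ge2$, with orthonormal basis $\{e_1,\dots,e_k\}$ and an orthonormal basis $\{e_{n+1},\dots,e_m\}$ of $B_p$, the algebraic Casorati curvature of $\Pi_k$ is $\mathcal C^{T,\zeta}(\Pi_k)=\frac1k\sum_{\alpha=n+1}^m\sum_{i,j=1}^k(\zeta_{ij}^\alpha)^2$, where $\zeta_{ij}^\alpha=g_B(\zeta(e_i,e_j),e_\alpha)$.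 Put $\mathcal C^{T,\zeta}_p=\mathcal C^{T,\zeta}(T_pM)=\frac1n\|\zeta\|^2$ at $p$. A hyperplane of $T_pM$ is an $(n-1)$-dimensional linear subspace. For a positive real number $r\ne n(n-1)$ let $\mathrm a(r)=\frac{1}{nr}(n-1)(n+r)(n^2-n-r)$, and define $$[\delta_{\mathcal C^{T,\zeta}}(r;n-1)]_p=r\,\mathcal C_p^{T,\zeta}+\mathrm a(r)\inf\{\mathcal C^{T,\zeta}(\Pi_{n-1}):\Pi_{n-1}\text{ a hyperplane of }T_pM\}\quad\text{if }0<r<n(n-1),$$ $$[\widehat\delta_{\mathcal C^{T,\zeta}}(r;n-1)]_p=r\,\mathcal C_p^{T,\zeta}+\mathrm a(r)\sup\{\mathcal C^{T,\zeta}(\Pi_{n-1}):\Pi_{n-1}\text{ a hyperplane of }T_pM\}\quad\text{if }n(n-1)<r.$$ *)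

theory Defs
  imports "HOL-Analysis.Analysis" "HOL-Library.Function_Algebras"
begin

text \<open>Functions into a real vector space form a real vector space under the pointwise
  operations. Tangent vectors live in such a space, so that \<open>subspace\<close>, \<open>span\<close> and \<open>dim\<close>
  apply to tangent spaces.\<close>

instantiation "fun" :: (type, real_vector) real_vector
begin

definition scaleR_fun :: "real \<Rightarrow> ('a \<Rightarrow> 'b) \<Rightarrow> 'a \<Rightarrow> 'b" where
  "scaleR_fun c f = (\<lambda>x. c *\<^sub>R f x)"

instance
  by standard (simp_all add: scaleR_fun_def plus_fun_def scaleR_add_right scaleR_add_left)

end

section \<open>Smooth manifolds\<close>

text \<open>\<open>C_k_on k S f\<close> is meant for open \<open>S\<close> in a finite-dimensional space.\<close>

primrec C_k_on :: "nat \<Rightarrow> 'a::real_normed_vector set \<Rightarrow> ('a \<Rightarrow> 'b::real_normed_vector) \<Rightarrow> bool" where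
  "C_k_on 0 S f \<longleftrightarrow> continuous_on S f"
| "C_k_on (Suc k) S f \<longleftrightarrow>
     (\<forall>x\<in>S. f differentiable (at x)) \<and> (\<forall>v. C_k_on k S (\<lambda>x. frechet_derivative f (at x) v))"

definition smooth_on :: "'a::real_normed_vector set \<Rightarrow> ('a \<Rightarrow> 'b::real_normed_vector) \<Rightarrow> bool" where
  "smooth_on S f \<longleftrightarrow> (\<forall>k. C_k_on k S f)"

text \<open>A chart is a pair of its domain and its coordinate map; the map is only meaningful on the
  domain, and likewise \<open>transition c d\<close> only on the image of the common domain of \<open>c\<close> and \<open>d\<close>.\<close>

type_synonym ('m, 'n) chart = "'m set \<times> ('m \<Rightarrow> real ^ 'n)"

definition transition ::
    "('m, 'n::finite) chart \<Rightarrow> ('m, 'n) chart \<Rightarrow> real ^ 'n \<Rightarrow> real ^ 'n" where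
  "transition c d = snd d \<circ> inv_into (fst c) (snd c)"

text \<open>A smooth manifold of dimension \<open>CARD('n)\<close>: the points are \<open>topspace X\<close>, and the smooth
  structure is given by an atlas, which need not be maximal.\<close>

definition smooth_manifold :: "'m topology \<Rightarrow> ('m, 'n::finite) chart set \<Rightarrow> bool" where
  "smooth_manifold X A \<longleftrightarrow>
     Hausdorff_space X \<and> second_countable X \<and>
     (\<Union>c\<in>A. fst c) = topspace X \<and>
     (\<forall>c\<in>A. openin X (fst c) \<and> open (snd c ` fst c) \<and>
        homeomorphic_map (subtopology X (fst c)) (top_of_set (snd c ` fst c)) (snd c)) \<and>
     (\<forall>c\<in>A. \<forall>d\<in>A. smooth_on (snd c ` (fst c \<inter> fst d)) (transition c d))"

definition smooth_function ::
    "('m, 'n::finite) chart set \<Rightarrow> 'm set \<Rightarrow> ('m \<Rightarrow> real) \<Rightarrow> bool" where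
  "smooth_function A U f \<longleftrightarrow>
     (\<forall>c\<in>A. smooth_on (snd c ` (U \<inter> fst c)) (f \<circ> inv_into (fst c) (snd c)))"

text \<open>A tangent vector at \<open>p\<close> assigns to each chart around \<open>p\<close> a coordinate vector, the coordinate
  vectors being related by the derivatives of the transition maps; by convention it assigns \<open>0\<close> to
  everything that is not a chart around \<open>p\<close>.\<close>

definition tangent_space ::
    "('m, 'n::finite) chart set \<Rightarrow> 'm \<Rightarrow> (('m, 'n) chart \<Rightarrow> real ^ 'n) set" where
  "tangent_space A p =
     {v. (\<forall>c. \<not> (c \<in> A \<and> p \<in> fst c) \<longrightarrow> v c = 0) \<and>
         (\<forall>c\<in>A. \<forall>d\<in>A. p \<in> fst c \<longrightarrow> p \<in> fst d \<longrightarrow>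
            v d = frechet_derivative (transition c d) (at (snd c p)) (v c))}"

text \<open>The coordinate vector field \<open>\<partial>/\<partial>x\<^sub>i\<close> of the chart \<open>c\<close>.\<close>

definition coord_field ::
    "('m, 'n::finite) chart set \<Rightarrow> ('m, 'n) chart \<Rightarrow> 'n \<Rightarrow> 'm \<Rightarrow> ('m, 'n) chart \<Rightarrow> real ^ 'n" where
  "coord_field A c i p =
     (\<lambda>d. if d \<in> A \<and> p \<in> fst d
          then frechet_derivative (transition c d) (at (snd c p)) (axis i 1) else 0)"

section \<open>Smooth vector bundles\<close>

text \<open>A vector bundle is given by its fibres \<open>F p\<close>, which are linear subspaces of an ambient real
  vector space carrying no further structure, and by a family of local frames (a domain together
  with fields indexed by a finite set \<open>I\<close>, i.e. a local trivialisation) that cover the base and are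
  related to each other by smooth coefficient functions.\<close>

type_synonym ('m, 'i, 'v) local_frame = "'m set \<times> ('i \<Rightarrow> 'm \<Rightarrow> 'v)"

definition smooth_section ::
    "('m, 'n::finite) chart set \<Rightarrow> 'i set \<Rightarrow> ('m, 'i, 'v::real_vector) local_frame set \<Rightarrow>
     'm set \<Rightarrow> ('m \<Rightarrow> 'v) \<Rightarrow> bool" where
  "smooth_section A I Fr W s \<longleftrightarrow>
     (\<forall>(U, t)\<in>Fr. \<exists>a. (\<forall>i\<in>I. smooth_function A (W \<inter> U) (a i)) \<and>
        (\<forall>p\<in>W \<inter> U. s p = (\<Sum>i\<in>I. a i p *\<^sub>R t i p)))"

definition smooth_vector_bundle ::
    "'m topology \<Rightarrow> ('m, 'n::finite) chart set \<Rightarrow> nat \<Rightarrow>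
     ('m \<Rightarrow> 'v::real_vector set) \<Rightarrow> ('m, nat, 'v) local_frame set \<Rightarrow> bool" where
  "smooth_vector_bundle X A k F Fr \<longleftrightarrow>
     (\<forall>p\<in>topspace X. subspace (F p)) \<and>
     (\<Union>(U, t)\<in>Fr. U) = topspace X \<and>
     (\<forall>(U, t)\<in>Fr. openin X U \<and>
        (\<forall>p\<in>U. inj_on (\<lambda>i. t i p) {..<k} \<and> independent ((\<lambda>i. t i p) ` {..<k}) \<and>
                span ((\<lambda>i. t i p) ` {..<k}) = F p) \<and>
        (\<forall>j<k. smooth_section A {..<k} Fr U (t j)))"

definition coord_frames ::
    "('m, 'n::finite) chart set \<Rightarrow> ('m, 'n, ('m, 'n) chart \<Rightarrow> real ^ 'n) local_frame set" where
  "coord_frames A = (\<lambda>c. (fst c, coord_field A c)) ` A"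

definition vector_field ::
    "'m topology \<Rightarrow> ('m, 'n::finite) chart set \<Rightarrow> ('m \<Rightarrow> ('m, 'n) chart \<Rightarrow> real ^ 'n) \<Rightarrow> bool" where
  "vector_field X A V \<longleftrightarrow>
     (\<forall>p\<in>topspace X. V p \<in> tangent_space A p) \<and>
     smooth_section A UNIV (coord_frames A) (topspace X) V"

section \<open>Metrics and tensor fields\<close>

definition linear_on :: "'v::real_vector set \<Rightarrow> ('v \<Rightarrow> 'w::real_vector) \<Rightarrow> bool" where
  "linear_on S f \<longleftrightarrow>
     (\<forall>x\<in>S. \<forall>y\<in>S. f (x + y) = f x + f y) \<and> (\<forall>c. \<forall>x\<in>S. f (c *\<^sub>R x) = c *\<^sub>R f x)"

definition symmetric_bilinear_on ::
    "'v::real_vector set \<Rightarrow> ('v \<Rightarrow> 'v \<Rightarrow> 'w::real_vector) \<Rightarrow> bool" where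
  "symmetric_bilinear_on S b \<longleftrightarrow>
     (\<forall>x\<in>S. linear_on S (b x)) \<and> (\<forall>x\<in>S. \<forall>y\<in>S. b x y = b y x)"

definition inner_product_on ::
    "'v::real_vector set \<Rightarrow> ('v \<Rightarrow> 'v \<Rightarrow> real) \<Rightarrow> bool" where
  "inner_product_on S h \<longleftrightarrow> symmetric_bilinear_on S h \<and> (\<forall>x\<in>S. x \<noteq> 0 \<longrightarrow> h x x > 0)"

definition smooth_metric ::
    "'m topology \<Rightarrow> ('m, 'n::finite) chart set \<Rightarrow> 'i set \<Rightarrow> ('m \<Rightarrow> 'v::real_vector set) \<Rightarrow>
     ('m, 'i, 'v) local_frame set \<Rightarrow> ('m \<Rightarrow> 'v \<Rightarrow> 'v \<Rightarrow> real) \<Rightarrow> bool" where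
  "smooth_metric X A I F Fr h \<longleftrightarrow>
     (\<forall>p\<in>topspace X. inner_product_on (F p) (h p)) \<and>
     (\<forall>(U, t)\<in>Fr. \<forall>i\<in>I. \<forall>j\<in>I. smooth_function A U (\<lambda>p. h p (t i p) (t j p)))"

definition riemannian_manifold ::
    "'m topology \<Rightarrow> ('m, 'n::finite) chart set \<Rightarrow>
     ('m \<Rightarrow> (('m, 'n) chart \<Rightarrow> real ^ 'n) \<Rightarrow> (('m, 'n) chart \<Rightarrow> real ^ 'n) \<Rightarrow> real) \<Rightarrow> bool" where
  "riemannian_manifold X A g \<longleftrightarrow>
     smooth_manifold X A \<and> smooth_metric X A UNIV (tangent_space A) (coord_frames A) g"

definition riemannian_vector_bundle ::
    "'m topology \<Rightarrow> ('m, 'n::finite) chart set \<Rightarrow> nat \<Rightarrow> ('m \<Rightarrow> 'v::real_vector set) \<Rightarrow>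
     ('m, nat, 'v) local_frame set \<Rightarrow> ('m \<Rightarrow> 'v \<Rightarrow> 'v \<Rightarrow> real) \<Rightarrow> bool" where
  "riemannian_vector_bundle X A k F Fr gB \<longleftrightarrow>
     smooth_vector_bundle X A k F Fr \<and> smooth_metric X A {..<k} F Fr gB"

definition symmetric_12_tensor_field ::
    "'m topology \<Rightarrow> ('m, 'n::finite) chart set \<Rightarrow> nat \<Rightarrow> ('m \<Rightarrow> 'v::real_vector set) \<Rightarrow>
     ('m, nat, 'v) local_frame set \<Rightarrow>
     ('m \<Rightarrow> (('m, 'n) chart \<Rightarrow> real ^ 'n) \<Rightarrow> (('m, 'n) chart \<Rightarrow> real ^ 'n) \<Rightarrow> 'v) \<Rightarrow> bool" where
  "symmetric_12_tensor_field X A k F Fr \<zeta> \<longleftrightarrow>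
     (\<forall>p\<in>topspace X. symmetric_bilinear_on (tangent_space A p) (\<zeta> p) \<and>
        (\<forall>x\<in>tangent_space A p. \<forall>y\<in>tangent_space A p. \<zeta> p x y \<in> F p)) \<and>
     (\<forall>(U, t)\<in>coord_frames A. \<forall>i j. smooth_section A {..<k} Fr U (\<lambda>p. \<zeta> p (t i p) (t j p)))"

definition tensor_field_04 ::
    "'m topology \<Rightarrow> ('m, 'n::finite) chart set \<Rightarrow>
     ('m \<Rightarrow> (('m, 'n) chart \<Rightarrow> real ^ 'n) \<Rightarrow> (('m, 'n) chart \<Rightarrow> real ^ 'n) \<Rightarrow>
        (('m, 'n) chart \<Rightarrow> real ^ 'n) \<Rightarrow> (('m, 'n) chart \<Rightarrow> real ^ 'n) \<Rightarrow> real) \<Rightarrow> bool" where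
  "tensor_field_04 X A T \<longleftrightarrow>
     (\<forall>p\<in>topspace X. \<forall>x\<in>tangent_space A p. \<forall>y\<in>tangent_space A p. \<forall>z\<in>tangent_space A p.
        linear_on (tangent_space A p) (\<lambda>w. T p w x y z) \<and>
        linear_on (tangent_space A p) (\<lambda>w. T p x w y z) \<and>
        linear_on (tangent_space A p) (\<lambda>w. T p x y w z) \<and>
        linear_on (tangent_space A p) (\<lambda>w. T p x y z w)) \<and>
     (\<forall>(U, t)\<in>coord_frames A. \<forall>i j k l.
        smooth_function A U (\<lambda>p. T p (t i p) (t j p) (t k p) (t l p)))"

definition curvature_like ::
    "'m topology \<Rightarrow> ('m, 'n::finite) chart set \<Rightarrow>
     ('m \<Rightarrow> (('m, 'n) chart \<Rightarrow> real ^ 'n) \<Rightarrow> (('m, 'n) chart \<Rightarrow> real ^ 'n) \<Rightarrow>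
        (('m, 'n) chart \<Rightarrow> real ^ 'n) \<Rightarrow> (('m, 'n) chart \<Rightarrow> real ^ 'n) \<Rightarrow> real) \<Rightarrow> bool" where
  "curvature_like X A T \<longleftrightarrow>
     tensor_field_04 X A T \<and>
     (\<forall>p\<in>topspace X. \<forall>x\<in>tangent_space A p. \<forall>y\<in>tangent_space A p.
      \<forall>z\<in>tangent_space A p. \<forall>w\<in>tangent_space A p.
        T p x y z w = - T p y x z w \<and>
        T p x y z w = T p z w x y \<and>
        T p x y z w + T p y z x w + T p z x y w = 0)"

section \<open>Scalar and Casorati curvatures\<close>

definition orthonormal_basis_on ::
    "('v::real_vector \<Rightarrow> 'v \<Rightarrow> real) \<Rightarrow> 'v set \<Rightarrow> nat set \<Rightarrow> (nat \<Rightarrow> 'v) \<Rightarrow> bool" where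
  "orthonormal_basis_on h S I e \<longleftrightarrow>
     (\<forall>i\<in>I. e i \<in> S) \<and> (\<forall>i\<in>I. \<forall>j\<in>I. h (e i) (e j) = (if i = j then 1 else 0)) \<and>
     span (e ` I) = S"

text \<open>The scalar and Casorati curvatures do not depend on the orthonormal bases, so they are
  computed in chosen ones.\<close>

definition scalar_curvature ::
    "('m, 'n::finite) chart set \<Rightarrow>
     ('m \<Rightarrow> (('m, 'n) chart \<Rightarrow> real ^ 'n) \<Rightarrow> (('m, 'n) chart \<Rightarrow> real ^ 'n) \<Rightarrow> real) \<Rightarrow>
     ('m \<Rightarrow> (('m, 'n) chart \<Rightarrow> real ^ 'n) \<Rightarrow> (('m, 'n) chart \<Rightarrow> real ^ 'n) \<Rightarrow>
        (('m, 'n) chart \<Rightarrow> real ^ 'n) \<Rightarrow> (('m, 'n) chart \<Rightarrow> real ^ 'n) \<Rightarrow> real) \<Rightarrow> 'm \<Rightarrow> real" where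
  "scalar_curvature A g T p =
     (let n = CARD('n); e = (SOME e. orthonormal_basis_on (g p) (tangent_space A p) {1..n} e)
      in \<Sum>i\<in>{1..n}. \<Sum>j\<in>{i<..n}. T p (e i) (e j) (e j) (e i))"

definition normalized_scalar_curvature ::
    "('m, 'n::finite) chart set \<Rightarrow>
     ('m \<Rightarrow> (('m, 'n) chart \<Rightarrow> real ^ 'n) \<Rightarrow> (('m, 'n) chart \<Rightarrow> real ^ 'n) \<Rightarrow> real) \<Rightarrow>
     ('m \<Rightarrow> (('m, 'n) chart \<Rightarrow> real ^ 'n) \<Rightarrow> (('m, 'n) chart \<Rightarrow> real ^ 'n) \<Rightarrow>
        (('m, 'n) chart \<Rightarrow> real ^ 'n) \<Rightarrow> (('m, 'n) chart \<Rightarrow> real ^ 'n) \<Rightarrow> real) \<Rightarrow> 'm \<Rightarrow> real" where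
  "normalized_scalar_curvature A g T p =
     2 / (real CARD('n) * (real CARD('n) - 1)) * scalar_curvature A g T p"

text \<open>\<open>casorati n m g F gB \<zeta> p P\<close> is the algebraic Casorati curvature of the subspace \<open>P\<close> of the
  tangent space at \<open>p\<close>; the numbers \<open>n\<close> and \<open>m\<close> only serve to index the basis of the fibre \<open>F p\<close>
  by \<open>{n+1..m}\<close>.\<close>

definition casorati ::
    "nat \<Rightarrow> nat \<Rightarrow> ('m \<Rightarrow> 't::real_vector \<Rightarrow> 't \<Rightarrow> real) \<Rightarrow>
     ('m \<Rightarrow> 'v::real_vector set) \<Rightarrow> ('m \<Rightarrow> 'v \<Rightarrow> 'v \<Rightarrow> real) \<Rightarrow>
     ('m \<Rightarrow> 't \<Rightarrow> 't \<Rightarrow> 'v) \<Rightarrow> 'm \<Rightarrow> 't set \<Rightarrow> real" where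
  "casorati n m g F gB \<zeta> p P =
     (let k = dim P;
          e = (SOME e. orthonormal_basis_on (g p) P {1..k} e);
          \<xi> = (SOME \<xi>. orthonormal_basis_on (gB p) (F p) {n+1..m} \<xi>)
      in 1 / real k * (\<Sum>\<alpha>\<in>{n+1..m}. \<Sum>i\<in>{1..k}. \<Sum>j\<in>{1..k}. (gB p (\<zeta> p (e i) (e j)) (\<xi> \<alpha>))\<^sup>2))"

definition hyperplanes ::
    "('m, 'n::finite) chart set \<Rightarrow> 'm \<Rightarrow> (('m, 'n) chart \<Rightarrow> real ^ 'n) set set" where
  "hyperplanes A p = {P. subspace P \<and> P \<subseteq> tangent_space A p \<and> dim P = CARD('n) - 1}"

definition coeff_a :: "nat \<Rightarrow> real \<Rightarrow> real" where
  "coeff_a n r = 1 / (real n * r) * (real n - 1) * (real n + r) * ((real n)\<^sup>2 - real n - r)"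

definition delta_casorati ::
    "nat \<Rightarrow> ('m, 'n::finite) chart set \<Rightarrow>
     ('m \<Rightarrow> (('m, 'n) chart \<Rightarrow> real ^ 'n) \<Rightarrow> (('m, 'n) chart \<Rightarrow> real ^ 'n) \<Rightarrow> real) \<Rightarrow>
     ('m \<Rightarrow> 'v::real_vector set) \<Rightarrow> ('m \<Rightarrow> 'v \<Rightarrow> 'v \<Rightarrow> real) \<Rightarrow>
     ('m \<Rightarrow> (('m, 'n) chart \<Rightarrow> real ^ 'n) \<Rightarrow> (('m, 'n) chart \<Rightarrow> real ^ 'n) \<Rightarrow> 'v) \<Rightarrow>
     real \<Rightarrow> 'm \<Rightarrow> real" where
  "delta_casorati m A g F gB \<zeta> r p =
     r * casorati CARD('n) m g F gB \<zeta> p (tangent_space A p) +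
     coeff_a CARD('n) r * (INF P\<in>hyperplanes A p. casorati CARD('n) m g F gB \<zeta> p P)"

definition delta_hat_casorati ::
    "nat \<Rightarrow> ('m, 'n::finite) chart set \<Rightarrow>
     ('m \<Rightarrow> (('m, 'n) chart \<Rightarrow> real ^ 'n) \<Rightarrow> (('m, 'n) chart \<Rightarrow> real ^ 'n) \<Rightarrow> real) \<Rightarrow>
     ('m \<Rightarrow> 'v::real_vector set) \<Rightarrow> ('m \<Rightarrow> 'v \<Rightarrow> 'v \<Rightarrow> real) \<Rightarrow>
     ('m \<Rightarrow> (('m, 'n) chart \<Rightarrow> real ^ 'n) \<Rightarrow> (('m, 'n) chart \<Rightarrow> real ^ 'n) \<Rightarrow> 'v) \<Rightarrow>
     real \<Rightarrow> 'm \<Rightarrow> real" where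
  "delta_hat_casorati m A g F gB \<zeta> r p =
     r * casorati CARD('n) m g F gB \<zeta> p (tangent_space A p) +
     coeff_a CARD('n) r * (SUP P\<in>hyperplanes A p. casorati CARD('n) m g F gB \<zeta> p P)"

definition has_equality_form ::
    "nat \<Rightarrow> ('m, 'n::finite) chart set \<Rightarrow>
     ('m \<Rightarrow> (('m, 'n) chart \<Rightarrow> real ^ 'n) \<Rightarrow> (('m, 'n) chart \<Rightarrow> real ^ 'n) \<Rightarrow> real) \<Rightarrow>
     ('m \<Rightarrow> 'v::real_vector set) \<Rightarrow> ('m \<Rightarrow> 'v \<Rightarrow> 'v \<Rightarrow> real) \<Rightarrow>
     ('m \<Rightarrow> (('m, 'n) chart \<Rightarrow> real ^ 'n) \<Rightarrow> (('m, 'n) chart \<Rightarrow> real ^ 'n) \<Rightarrow> 'v) \<Rightarrow>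
     real \<Rightarrow> 'm \<Rightarrow> bool" where
  "has_equality_form m A g F gB \<zeta> r p \<longleftrightarrow>
     (let n = CARD('n) in
      \<exists>e \<xi>. orthonormal_basis_on (g p) (tangent_space A p) {1..n} e \<and>
            orthonormal_basis_on (gB p) (F p) {n+1..m} \<xi> \<and>
            (\<forall>i\<in>{1..n}. \<forall>j\<in>{1..n}. \<forall>\<alpha>\<in>{n+1..m}. i \<noteq> j \<longrightarrow> gB p (\<zeta> p (e i) (e j)) (\<xi> \<alpha>) = 0) \<and>
            (\<forall>i\<in>{1..n-1}. \<forall>\<alpha>\<in>{n+1..m}.
               gB p (\<zeta> p (e i) (e i)) (\<xi> \<alpha>) =
               r / (real n * (real n - 1)) * gB p (\<zeta> p (e n) (e n)) (\<xi> \<alpha>)))"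

end

theory Submission
  imports Defs
begin

text \<open>Every tangent vector at \<open>p\<close> extends to a smooth vector field by means of a bump function,
  so the Gauss equation holds for tangent vectors. Given a hyperplane \<open>\<Pi>\<close>, take an orthonormal basis
  of the tangent space whose first \<open>n - 1\<close> vectors span \<open>\<Pi>\<close>. Then \<open>r \<C> + a(r) \<C>(\<Pi>) - 2\<tau>\<close> is a sum
  over the normal directions of quadratic forms in the components of \<open>\<zeta>\<close>: the off-diagonal
  components enter as squares with positive coefficients, and the diagonal ones as
  \<open>A \<Sum>\<^sub>i x\<^sub>i\<^sup>2 + B y\<^sup>2 - (\<Sum>\<^sub>i x\<^sub>i + y)\<^sup>2\<close> with \<open>(n - 1) / A + 1 / B = 1\<close>. By Cauchy-Schwarz this is
  nonnegative, and it vanishes exactly when all \<open>x\<^sub>i\<close> equal \<open>(B / A) y = r / (n (n - 1)) y\<close>. As \<open>a(r)\<close>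
  is positive for \<open>r < n (n - 1)\<close> and negative for \<open>r > n (n - 1)\<close>, the best choice of \<open>\<Pi>\<close> is the
  infimum or the supremum respectively.\<close>

section \<open>Smooth functions on open sets\<close>

lemma C_k_on_cong:
  assumes "open S" "\<And>x. x \<in> S \<Longrightarrow> f x = g x" "C_k_on k S f"
  shows "C_k_on k S g"
  using assms(2,3)
proof (induction k arbitrary: f g)
  case 0
  then show ?case by (auto cong: continuous_on_cong)
next
  case (Suc k)
  \<comment> \<open>As \<open>S\<close> is open, \<open>g\<close> coincides with \<open>f\<close> on
    a neighbourhood of \<open>x\<close> and so inherits its derivative there.\<close>
  have der: "(g has_derivative frechet_derivative f (at x)) (at x)" if "x \<in> S" for x
  proof (rule has_derivative_transform_within_open[OF _ \<open>open S\<close> that Suc.prems(1)])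
    show "(f has_derivative frechet_derivative f (at x)) (at x)"
      using Suc.prems(2) that by (simp flip: frechet_derivative_works)
  qed
  have eq: "frechet_derivative g (at x) = frechet_derivative f (at x)" if "x \<in> S" for x
    using frechet_derivative_at[OF der[OF that]] by simp
  have "C_k_on k S (\<lambda>x. frechet_derivative g (at x) v)" for v
    by (rule Suc.IH[of "\<lambda>x. frechet_derivative f (at x) v"]) (use Suc.prems(2) eq in auto)
  then show ?case
    using der by (auto simp: differentiable_def)
qed

lemma C_k_on_subset: "C_k_on k S f \<Longrightarrow> T \<subseteq> S \<Longrightarrow> C_k_on k T f"
  by (induction k arbitrary: f) (auto intro: continuous_on_subset)

lemma C_k_on_Suc_imp: "C_k_on (Suc k) S f \<Longrightarrow> C_k_on k S f"
  by (induction k arbitrary: f)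
    (auto intro!: differentiable_imp_continuous_on differentiable_at_imp_differentiable_on)

lemma C_k_on_Un:
  assumes "open S" "open T" "C_k_on k S f" "C_k_on k T f"
  shows "C_k_on k (S \<union> T) f"
  using assms(3,4)
  by (induction k arbitrary: f) (auto intro: continuous_on_open_Un assms(1,2))

lemma C_k_on_const: "C_k_on k S (\<lambda>x. c)"
  by (induction k arbitrary: c) auto

lemma C_k_on_bounded_linear:
  assumes "bounded_linear L"
  shows "C_k_on k S L"
proof (cases k)
  case 0
  then show ?thesis by (simp add: assms linear_continuous_on)
next
  case (Suc j)
  have "(L has_derivative L) (at x)" for x
    by (simp add: assms bounded_linear_imp_has_derivative)
  then have "frechet_derivative L (at x) = L" "L differentiable (at x)" for x
    by (auto simp: differentiable_def dest: frechet_derivative_at[symmetric])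
  then show ?thesis by (simp add: Suc C_k_on_const)
qed

text \<open>The derivative is identified with the explicit rule only at points of \<open>S\<close>,
  so the induction differentiates once by the sum rule and transfers the result with
  \<open>C_k_on_cong\<close>. Products and compositions follow the same scheme.\<close>

lemma C_k_on_add:
  assumes "open S" "C_k_on k S f" "C_k_on k S g"
  shows "C_k_on k S (\<lambda>x. f x + g x)"
  using assms(2,3)
proof (induction k arbitrary: f g)
  case 0
  then show ?case by (auto intro: continuous_on_add)
next
  case (Suc k)
  have der: "((\<lambda>x. f x + g x) has_derivative
      (\<lambda>v. frechet_derivative f (at x) v + frechet_derivative g (at x) v)) (at x)"
    if "x \<in> S" for x
    using Suc.prems that by (intro has_derivative_add) (auto simp flip: frechet_derivative_works)
  have "C_k_on k S (\<lambda>x. frechet_derivative (\<lambda>x. f x + g x) (at x) v)" for v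
  proof (rule C_k_on_cong[OF \<open>open S\<close>])
    show "C_k_on k S (\<lambda>x. frechet_derivative f (at x) v + frechet_derivative g (at x) v)"
      using Suc.prems by (intro Suc.IH) auto
    show "frechet_derivative f (at x) v + frechet_derivative g (at x) v =
        frechet_derivative (\<lambda>x. f x + g x) (at x) v" if "x \<in> S" for x
      by (simp flip: frechet_derivative_at[OF der[OF that]])
  qed
  then show ?case using der by (auto simp: differentiable_def)
qed

lemma C_k_on_sum:
  assumes "open S" "\<And>i. i \<in> I \<Longrightarrow> C_k_on k S (f i)"
  shows "C_k_on k S (\<lambda>x. \<Sum>i\<in>I. f i x)"
  using assms(2)
  by (induction I rule: infinite_finite_induct)
    (auto intro!: C_k_on_const C_k_on_add \<open>open S\<close>)

lemma (in bounded_bilinear) C_k_on: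
  assumes "open S" "C_k_on k S f" "C_k_on k S g"
  shows "C_k_on k S (\<lambda>x. prod (f x) (g x))"
  using assms(2,3)
proof (induction k arbitrary: f g)
  case 0
  then show ?case by (auto intro: continuous_on)
next
  case (Suc k)
  have der: "((\<lambda>x. prod (f x) (g x)) has_derivative
      (\<lambda>v. prod (f x) (frechet_derivative g (at x) v) + prod (frechet_derivative f (at x) v) (g x))) (at x)"
    if "x \<in> S" for x
    using Suc.prems that by (intro FDERIV) (auto simp flip: frechet_derivative_works)
  have "C_k_on k S (\<lambda>x. frechet_derivative (\<lambda>x. prod (f x) (g x)) (at x) v)" for v
  proof (rule C_k_on_cong[OF \<open>open S\<close>])
    \<comment> \<open>Each summand pairs a derivative, known to be C^k, with an undifferentiated
      factor, known to be C^(k+1); \<open>C_k_on_Suc_imp\<close> lowers the latter so that the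
      induction hypothesis fits both.\<close>
    show "C_k_on k S (\<lambda>x. prod (f x) (frechet_derivative g (at x) v) +
        prod (frechet_derivative f (at x) v) (g x))"
      using Suc.prems Suc.prems[THEN C_k_on_Suc_imp] by (intro C_k_on_add[OF \<open>open S\<close>] Suc.IH) auto
    show "prod (f x) (frechet_derivative g (at x) v) + prod (frechet_derivative f (at x) v) (g x) =
        frechet_derivative (\<lambda>x. prod (f x) (g x)) (at x) v" if "x \<in> S" for x
      by (simp flip: frechet_derivative_at[OF der[OF that]])
  qed
  then show ?case using der by (auto simp: differentiable_def)
qed

text \<open>\<open>C_k_on\<close> controls derivatives in a fixed direction, whereas the chain rule
  evaluates the derivative of \<open>g\<close> in the direction
  \<open>frechet_derivative f (at x) v\<close>, which moves with \<open>x\<close>. Expanding it in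
  the basis of the Euclidean middle space reduces to fixed directions.\<close>

lemma C_k_on_compose:
  fixes f :: "'a::real_normed_vector \<Rightarrow> 'b::euclidean_space" and g :: "'b \<Rightarrow> 'c::real_normed_vector"
  assumes "open S" "C_k_on k S f" "C_k_on k T g" "f ` S \<subseteq> T"
  shows "C_k_on k S (\<lambda>x. g (f x))"
  using assms(2,3)
proof (induction k arbitrary: g)
  case 0
  then show ?case using assms(4) by (auto intro: continuous_on_compose2)
next
  case (Suc k)
  have der: "((\<lambda>x. g (f x)) has_derivative
      (\<lambda>v. frechet_derivative g (at (f x)) (frechet_derivative f (at x) v))) (at x)"
    if "x \<in> S" for x
  proof -
    have "(f has_derivative frechet_derivative f (at x)) (at x)"
      "(g has_derivative frechet_derivative g (at (f x))) (at (f x))"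
      using Suc.prems that assms(4) by (auto simp flip: frechet_derivative_works)
    then show ?thesis using diff_chain_at by (fastforce simp: o_def)
  qed
  have expand: "frechet_derivative g (at (f x)) (frechet_derivative f (at x) v) =
      (\<Sum>b\<in>Basis. (frechet_derivative f (at x) v \<bullet> b) *\<^sub>R frechet_derivative g (at (f x)) b)"
    if "x \<in> S" for x v
  proof -
    have "linear (frechet_derivative g (at (f x)))"
      using Suc.prems(2) that assms(4) by (auto intro: linear_frechet_derivative)
    then show ?thesis
      by (subst euclidean_representation[symmetric, of "frechet_derivative f (at x) v"])
        (simp only: linear_sum linear_cmul)
  qed
  have "C_k_on k S (\<lambda>x. frechet_derivative (\<lambda>x. g (f x)) (at x) v)" for v
  proof (rule C_k_on_cong[OF \<open>open S\<close>])
    have "C_k_on k S (\<lambda>x. frechet_derivative f (at x) v \<bullet> b)" for b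
      by (intro bounded_bilinear.C_k_on[OF bounded_bilinear_inner] \<open>open S\<close> C_k_on_const)
        (use Suc.prems in auto)
    moreover have "C_k_on k S (\<lambda>x. frechet_derivative g (at (f x)) b)" for b
      using Suc.prems C_k_on_Suc_imp by (intro Suc.IH) auto
    ultimately show "C_k_on k S (\<lambda>x. \<Sum>b\<in>Basis. (frechet_derivative f (at x) v \<bullet> b) *\<^sub>R
        frechet_derivative g (at (f x)) b)"
      by (intro C_k_on_sum bounded_bilinear.C_k_on[OF bounded_bilinear_scaleR] \<open>open S\<close>)
    show "(\<Sum>b\<in>Basis. (frechet_derivative f (at x) v \<bullet> b) *\<^sub>R frechet_derivative g (at (f x)) b) =
        frechet_derivative (\<lambda>x. g (f x)) (at x) v" if "x \<in> S" for x
      by (simp add: expand[OF that] flip: frechet_derivative_at[OF der[OF that]])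
  qed
  then show ?case using der by (auto simp: differentiable_def)
qed

section \<open>Bump functions\<close>

text \<open>The polynomial factor makes this family of functions closed under differentiation.\<close>

definition flat_exp :: "real poly \<Rightarrow> real \<Rightarrow> real" where
  "flat_exp q t = (if t > 0 then poly q (1 / t) * exp (- (1 / t)) else 0)"

text \<open>This is the limit of the difference quotient at 0, since
  \<open>flat_exp q 0 = 0\<close>. Replacing t by 1/t turns the right-hand limit into the decay of t
  q(t) exp(-t) at infinity, where \<open>pCons 0 q\<close> is t q(t); on the left the function
  vanishes.\<close>

lemma flat_exp_over_tendsto_0:
  "((\<lambda>t. flat_exp q t / t) \<longlongrightarrow> 0) (at 0)"
proof -
  have "((\<lambda>t. poly (pCons 0 q) t * exp (- t)) \<longlongrightarrow> (0::real)) at_top"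
  proof -
    have "((\<lambda>t. poly q t / exp t) \<longlongrightarrow> (0::real)) at_top" for q
    proof -
      have "((\<lambda>t. \<Sum>i\<le>degree q. coeff q i * (t ^ i / exp t)) \<longlongrightarrow> (\<Sum>i\<le>degree q. coeff q i * 0)) at_top"
        by (intro tendsto_intros tendsto_power_div_exp_0)
      then show ?thesis by (simp add: poly_altdef sum_divide_distrib)
    qed
    from this[of "pCons 0 q"] show ?thesis by (simp add: exp_minus field_simps)
  qed
  then have "((\<lambda>t. poly (pCons 0 q) (inverse t) * exp (- inverse t)) \<longlongrightarrow> (0::real)) (at_right 0)"
    by (rule filterlim_compose) (rule filterlim_inverse_at_top_right)
  then have "((\<lambda>t. flat_exp q t / t) \<longlongrightarrow> 0) (at_right 0)"
    by (rule Lim_transform_eventually)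
      (auto simp: flat_exp_def eventually_at_filter field_simps)
  moreover have "((\<lambda>t. flat_exp q t / t) \<longlongrightarrow> 0) (at_left 0)"
    by (rule Lim_transform_eventually[OF tendsto_const])
      (auto simp: flat_exp_def eventually_at_filter)
  ultimately show ?thesis by (simp add: filterlim_split_at)
qed

text \<open>For t > 0 the product rule gives (q - q')(1/t) exp(-1/t) / t^2, and
  \<open>[:0, 0, 1:]\<close> is the square of the variable 1/t. At 0 the claimed derivative is 0, by
  the preceding limit.\<close>

lemma flat_exp_has_real_derivative:
  "(flat_exp q has_real_derivative flat_exp ([:0, 0, 1:] * (q - pderiv q)) t) (at t)"
proof -
  consider "t > 0" | "t < 0" | "t = 0" by linarith
  then show ?thesis
  proof cases
    case 1
    have "((\<lambda>t. poly q (1 / t) * exp (- (1 / t))) has_real_derivative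
        flat_exp ([:0, 0, 1:] * (q - pderiv q)) t) (at t)"
      using 1 by (auto intro!: derivative_eq_intros DERIV_chain'[where g="poly q"] poly_DERIV
          simp: flat_exp_def field_simps power2_eq_square)
    then show ?thesis
      by (rule has_field_derivative_transform_within_open[where S="{0<..}"])
        (use 1 in \<open>auto simp: flat_exp_def\<close>)
  next
    case 2
    have "((\<lambda>t. 0) has_real_derivative 0) (at t)" by simp
    then have "(flat_exp q has_real_derivative 0) (at t)"
      by (rule has_field_derivative_transform_within_open[where S="{..<0}"])
        (use 2 in \<open>auto simp: flat_exp_def\<close>)
    then show ?thesis using 2 by (simp add: flat_exp_def)
  next
    case 3
    then show ?thesis
      using flat_exp_over_tendsto_0[of q] by (simp add: DERIV_def flat_exp_def)
  qed
qed

lemma C_k_on_flat_exp: "C_k_on k UNIV (flat_exp q)"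
proof (induction k arbitrary: q)
  case 0
  have "isCont (flat_exp q) x" for x
    using flat_exp_has_real_derivative DERIV_isCont by blast
  then show ?case by (simp add: continuous_at_imp_continuous_on)
next
  case (Suc k)
  let ?q = "[:0, 0, 1:] * (q - pderiv q)"
  have der: "(flat_exp q has_derivative (\<lambda>v. v * flat_exp ?q t)) (at t)" for t
    using flat_exp_has_real_derivative[of q t]
    by (simp add: has_field_derivative_def mult.commute[of _ "flat_exp _ _"] mult_commute_abs)
  have "frechet_derivative (flat_exp q) (at t) = (\<lambda>v. v * flat_exp ?q t)" for t
    by (simp flip: frechet_derivative_at[OF der])
  moreover have "C_k_on k UNIV (\<lambda>t. v * flat_exp ?q t)" for v
    by (intro bounded_bilinear.C_k_on[OF bounded_bilinear_mult] C_k_on_const Suc) simp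
  ultimately show ?case using der by (auto simp: differentiable_def)
qed

text \<open>The number \<open>e\<^sup>2 - (x - a) \<bullet> (x - a)\<close> is positive exactly
  inside the ball, so composing it with \<open>flat_exp 1\<close> cuts off there; dividing by the
  value at the centre normalizes.\<close>

lemma ex_bump:
  fixes a :: "'a::euclidean_space"
  assumes "e > 0"
  obtains \<beta> :: "'a \<Rightarrow> real" where "smooth_on UNIV \<beta>" "\<beta> a = 1" "\<And>x. x \<notin> ball a e \<Longrightarrow> \<beta> x = 0"
proof -
  define \<beta> where "\<beta> x = flat_exp 1 (e\<^sup>2 - (x - a) \<bullet> (x - a)) / flat_exp 1 (e\<^sup>2)" for x
  have pos: "flat_exp 1 (e\<^sup>2) > 0" using assms by (simp add: flat_exp_def)
  have "C_k_on k UNIV \<beta>" for k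
  proof -
    have lin: "C_k_on k UNIV (\<lambda>x::'a. x + - a)"
      by (intro C_k_on_add C_k_on_const C_k_on_bounded_linear) (auto simp: bounded_linear_ident)
    have "C_k_on k UNIV (\<lambda>x. e\<^sup>2 + (-1) * ((x + - a) \<bullet> (x + - a)))"
      by (intro C_k_on_add C_k_on_const bounded_bilinear.C_k_on[OF bounded_bilinear_mult]
          bounded_bilinear.C_k_on[OF bounded_bilinear_inner] lin) auto
    then have "C_k_on k UNIV (\<lambda>x. inverse (flat_exp 1 (e\<^sup>2)) *
        flat_exp 1 (e\<^sup>2 + (-1) * ((x + - a) \<bullet> (x + - a))))"
      by (intro bounded_bilinear.C_k_on[OF bounded_bilinear_mult] C_k_on_const
          C_k_on_compose[where g="flat_exp 1", OF _ _ C_k_on_flat_exp]) auto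
    then show ?thesis by (simp add: \<beta>_def[abs_def] divide_inverse mult.commute)
  qed
  then have "smooth_on UNIV \<beta>" by (simp add: smooth_on_def)
  moreover have "\<beta> a = 1" using pos by (simp add: \<beta>_def)
  moreover have "\<beta> x = 0" if "x \<notin> ball a e" for x
  proof -
    have "e \<le> norm (x - a)" using that by (simp add: dist_norm norm_minus_commute)
    then have "e\<^sup>2 \<le> (x - a) \<bullet> (x - a)" using assms by (simp add: power_mono dot_square_norm)
    then show ?thesis by (simp add: \<beta>_def flat_exp_def)
  qed
  ultimately show thesis by (rule that)
qed

section \<open>Tangent vectors and their extension to vector fields\<close>

locale manifold =
  fixes X :: "'m topology" and A :: "('m, 'n::finite) chart set"
  assumes smooth_manifold: "smooth_manifold X A"
begin

abbreviation D :: "('m, 'n) chart \<Rightarrow> ('m, 'n) chart \<Rightarrow> 'm \<Rightarrow> real ^ 'n \<Rightarrow> real ^ 'n" where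
  "D c d q \<equiv> frechet_derivative (transition c d) (at (snd c q))"

lemma openin_chart: "c \<in> A \<Longrightarrow> openin X (fst c)"
  using smooth_manifold by (auto simp: smooth_manifold_def)

lemma chart_subset: "c \<in> A \<Longrightarrow> fst c \<subseteq> topspace X"
  by (simp add: openin_chart openin_subset)

lemma homeomorphic_map_chart:
  "c \<in> A \<Longrightarrow> homeomorphic_map (subtopology X (fst c)) (top_of_set (snd c ` fst c)) (snd c)"
  using smooth_manifold by (auto simp: smooth_manifold_def)

lemma open_chart_range: "c \<in> A \<Longrightarrow> open (snd c ` fst c)"
  using smooth_manifold by (auto simp: smooth_manifold_def)

lemma ex_chart: "q \<in> topspace X \<Longrightarrow> \<exists>c\<in>A. q \<in> fst c"
  using smooth_manifold by (auto simp: smooth_manifold_def)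

lemma C_k_on_transition:
  "c \<in> A \<Longrightarrow> d \<in> A \<Longrightarrow> C_k_on k (snd c ` (fst c \<inter> fst d)) (transition c d)"
  using smooth_manifold by (auto simp: smooth_manifold_def smooth_on_def)

lemma inj_on_chart: "c \<in> A \<Longrightarrow> inj_on (snd c) (fst c)"
  using homeomorphic_imp_injective_map[OF homeomorphic_map_chart] chart_subset
  by (simp add: topspace_subtopology inf.absorb2)

lemma inv_into_chart [simp]: "c \<in> A \<Longrightarrow> q \<in> fst c \<Longrightarrow> inv_into (fst c) (snd c) (snd c q) = q"
  by (simp add: inj_on_chart)

lemma transition_apply [simp]: "c \<in> A \<Longrightarrow> q \<in> fst c \<Longrightarrow> transition c d (snd c q) = snd d q"
  by (simp add: transition_def)

lemma open_chart_image:
  assumes "c \<in> A" "openin X U" "U \<subseteq> fst c"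
  shows "open (snd c ` U)"
proof -
  have "openin (subtopology X (fst c)) U"
    using assms by (simp add: openin_open_subtopology openin_chart)
  then have "openin (top_of_set (snd c ` fst c)) (snd c ` U)"
    using homeomorphic_imp_open_map[OF homeomorphic_map_chart[OF \<open>c \<in> A\<close>]]
    by (simp add: open_map_def)
  then show ?thesis
    using openin_open_eq[OF open_chart_range[OF \<open>c \<in> A\<close>]] by blast
qed

lemma open_chart_overlap: "c \<in> A \<Longrightarrow> d \<in> A \<Longrightarrow> open (snd c ` (fst c \<inter> fst d))"
  by (intro open_chart_image) (auto intro: openin_chart)

lemma transition_has_derivative:
  assumes "c \<in> A" "d \<in> A" "q \<in> fst c" "q \<in> fst d"
  shows "(transition c d has_derivative D c d q) (at (snd c q))"
  using C_k_on_transition[OF assms(1,2), of "Suc 0"] assms(3,4)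
  by (auto simp flip: frechet_derivative_works)

lemma linear_D: "c \<in> A \<Longrightarrow> d \<in> A \<Longrightarrow> q \<in> fst c \<Longrightarrow> q \<in> fst d \<Longrightarrow> linear (D c d q)"
  using transition_has_derivative has_derivative_linear by blast

text \<open>The chain rule, giving the cocycle condition that makes tangent vectors consistent
  across charts. The composite of two transitions is compared with the direct one only on the
  coordinate image of the overlap of \<open>c\<close> and \<open>d\<close>, which is open.\<close>

lemma D_trans:
  assumes "c \<in> A" "d \<in> A" "e \<in> A" "q \<in> fst c" "q \<in> fst d" "q \<in> fst e"
  shows "D c e q w = D d e q (D c d q w)"
proof -
  have "(transition d e \<circ> transition c d has_derivative D d e q \<circ> D c d q) (at (snd c q))"
    using assms transition_has_derivative by (intro diff_chain_at) auto
  then have "(transition c e has_derivative D d e q \<circ> D c d q) (at (snd c q))"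
    by (rule has_derivative_transform_within_open[OF _ open_chart_overlap[OF assms(1,2)]])
      (use assms in auto)
  from frechet_derivative_at[OF this] show ?thesis by (simp add: o_def fun_eq_iff)
qed

lemma D_same [simp]:
  assumes "c \<in> A" "q \<in> fst c"
  shows "D c c q w = w"
proof -
  have "(transition c c has_derivative (\<lambda>x. x)) (at (snd c q))"
    by (rule has_derivative_transform_within_open[OF has_derivative_ident open_chart_range[OF assms(1)]])
      (use assms in auto)
  from frechet_derivative_at[OF this] show ?thesis by metis
qed

text \<open>For a chart \<open>c\<close> around \<open>q\<close> this inverts the evaluation of a
  tangent vector at \<open>c\<close>, identifying \<open>real ^ 'n\<close> with the tangent space at
  \<open>q\<close>.\<close>

definition tangent_vector :: "('m, 'n) chart \<Rightarrow> 'm \<Rightarrow> real ^ 'n \<Rightarrow> ('m, 'n) chart \<Rightarrow> real ^ 'n" where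
  "tangent_vector c q w = (\<lambda>d. if d \<in> A \<and> q \<in> fst d then D c d q w else 0)"

lemma coord_field_eq: "coord_field A c i q = tangent_vector c q (axis i 1)"
  by (simp add: coord_field_def tangent_vector_def)

lemma tangent_space_eq_0:
  "v \<in> tangent_space A q \<Longrightarrow> \<not> (d \<in> A \<and> q \<in> fst d) \<Longrightarrow> v d = 0"
  unfolding tangent_space_def by blast

lemma tangent_space_change:
  "v \<in> tangent_space A q \<Longrightarrow> c \<in> A \<Longrightarrow> d \<in> A \<Longrightarrow> q \<in> fst c \<Longrightarrow> q \<in> fst d \<Longrightarrow> v d = D c d q (v c)"
  unfolding tangent_space_def by blast

lemma tangent_spaceI:
  assumes "\<And>d. \<not> (d \<in> A \<and> q \<in> fst d) \<Longrightarrow> v d = 0"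
    and "\<And>c d. c \<in> A \<Longrightarrow> d \<in> A \<Longrightarrow> q \<in> fst c \<Longrightarrow> q \<in> fst d \<Longrightarrow> v d = D c d q (v c)"
  shows "v \<in> tangent_space A q"
  using assms unfolding tangent_space_def by blast

lemma subspace_tangent_space: "subspace (tangent_space A q)"
proof (rule subspaceI)
  show "0 \<in> tangent_space A q"
    by (rule tangent_spaceI) (simp_all add: zero_fun_def linear_0[OF linear_D])
  fix x y assume xy: "x \<in> tangent_space A q" "y \<in> tangent_space A q"
  show "x + y \<in> tangent_space A q"
  proof (rule tangent_spaceI)
    show "(x + y) d = 0" if "\<not> (d \<in> A \<and> q \<in> fst d)" for d
      using tangent_space_eq_0[OF xy(1) that] tangent_space_eq_0[OF xy(2) that] by (simp add: plus_fun_def)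
    show "(x + y) d = D c d q ((x + y) c)"
      if "c \<in> A" "d \<in> A" "q \<in> fst c" "q \<in> fst d" for c d
      unfolding plus_fun_def linear_add[OF linear_D[OF that]]
        tangent_space_change[OF xy(1) that, symmetric] tangent_space_change[OF xy(2) that, symmetric] ..
  qed
  fix a :: real
  show "a *\<^sub>R x \<in> tangent_space A q"
  proof (rule tangent_spaceI)
    show "(a *\<^sub>R x) d = 0" if "\<not> (d \<in> A \<and> q \<in> fst d)" for d
      using tangent_space_eq_0[OF xy(1) that] by (simp add: scaleR_fun_def)
    show "(a *\<^sub>R x) d = D c d q ((a *\<^sub>R x) c)"
      if "c \<in> A" "d \<in> A" "q \<in> fst c" "q \<in> fst d" for c d
      unfolding scaleR_fun_def linear_cmul[OF linear_D[OF that]]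
        tangent_space_change[OF xy(1) that, symmetric] ..
  qed
qed

context
  fixes c :: "('m, 'n) chart" and q :: 'm
  assumes c: "c \<in> A" "q \<in> fst c"
begin

lemma linear_tangent_vector: "linear (tangent_vector c q)"
  using c by (intro linearI)
    (auto simp: tangent_vector_def plus_fun_def scaleR_fun_def linear_add[OF linear_D]
      linear_cmul[OF linear_D] fun_eq_iff)

lemma tangent_vector_mem: "tangent_vector c q w \<in> tangent_space A q"
proof (rule tangent_spaceI)
  show "tangent_vector c q w d = D c' d q (tangent_vector c q w c')"
    if "c' \<in> A" "d \<in> A" "q \<in> fst c'" "q \<in> fst d" for c' d
    using that D_trans[OF c(1) that(1,2) c(2) that(3,4)] by (simp add: tangent_vector_def)
qed (auto simp: tangent_vector_def)

lemma tangent_vector_same [simp]: "tangent_vector c q w c = w"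
  using c by (simp add: tangent_vector_def)

lemma tangent_vector_eq:
  assumes "v \<in> tangent_space A q"
  shows "tangent_vector c q (v c) = v"
proof
  fix d show "tangent_vector c q (v c) d = v d"
    using tangent_space_change[OF assms c(1) _ c(2), of d] tangent_space_eq_0[OF assms, of d]
    by (auto simp: tangent_vector_def)
qed

text \<open>The standard basis is carried over by the linear bijection
  \<open>tangent_vector c q\<close>; evaluation at \<open>c\<close> undoes it, whence
  injectivity.\<close>

lemma tangent_space_basis:
  "\<exists>B. finite B \<and> independent B \<and> span B = tangent_space A q \<and> card B = CARD('n)"
proof (intro exI conjI)
  have inj: "inj (tangent_vector c q)"
    by (metis injI tangent_vector_same)
  show "finite (tangent_vector c q ` Basis)" by simp
  show "independent (tangent_vector c q ` Basis)"
    by (rule linear_independent_injective_image[OF linear_tangent_vector independent_Basis])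
      (use inj in simp)
  have "range (tangent_vector c q) = tangent_space A q"
  proof (intro equalityI subsetI)
    show "v \<in> range (tangent_vector c q)" if "v \<in> tangent_space A q" for v
      using tangent_vector_eq[OF that] by (rule range_eqI[OF sym])
  qed (use tangent_vector_mem in auto)
  then show "span (tangent_vector c q ` Basis) = tangent_space A q"
    by (simp add: linear_span_image[OF linear_tangent_vector])
  show "card (tangent_vector c q ` Basis) = CARD('n)"
    by (simp add: card_image inj_on_subset[OF inj])
qed

end

text \<open>Supplies the frame coefficients of a vector given in chart \<open>c\<close> with respect
  to any other chart \<open>d\<close>, as smoothness of a vector field has to be checked in every
  coordinate frame.\<close>

lemma tangent_vector_change:
  assumes "c \<in> A" "d \<in> A" "q \<in> fst c" "q \<in> fst d"
  shows "tangent_vector c q w = (\<Sum>i\<in>UNIV. (D c d q w) $ i *\<^sub>R coord_field A d i q)"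
proof -
  have "tangent_vector c q w = tangent_vector d q (tangent_vector c q w d)"
    using assms by (simp add: tangent_vector_eq tangent_vector_mem)
  also have "tangent_vector c q w d = D c d q w"
    using assms by (simp add: tangent_vector_def)
  also have "\<dots> = (\<Sum>i\<in>UNIV. (D c d q w) $ i *\<^sub>R axis i 1)"
    using basis_expansion[of "D c d q w"] by (simp add: scalar_mult_eq_scaleR)
  finally show ?thesis
    by (simp only: linear_sum[OF linear_tangent_vector[OF assms(2,4)]]
        linear_cmul[OF linear_tangent_vector[OF assms(2,4)]] coord_field_eq)
qed

text \<open>The field has constant coordinates in one chart, is damped by a bump function and is
  extended by zero. The work lies in showing that the extension is smooth at the edge of the chart
  domain.\<close>

lemma ex_vector_field_through:
  assumes "p \<in> topspace X" "v \<in> tangent_space A p"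
  obtains V where "vector_field X A V" "V p = v"
proof -
  obtain c where c: "c \<in> A" "p \<in> fst c"
    using ex_chart[OF assms(1)] by (rule bexE)
  \<comment> \<open>A closed ball is chosen for its compactness.\<close>
  have "\<exists>e>0. cball (snd c p) e \<subseteq> snd c ` fst c"
    using open_chart_range[OF c(1)] imageI[OF c(2), of "snd c"] by (simp only: open_contains_cball)
  then obtain e where e: "e > 0" "cball (snd c p) e \<subseteq> snd c ` fst c"
    by (elim exE conjE)
  obtain \<beta> where \<beta>: "smooth_on UNIV \<beta>" "\<beta> (snd c p) = 1" "\<And>x. x \<notin> ball (snd c p) e \<Longrightarrow> \<beta> x = (0::real)"
    by (rule ex_bump[OF e(1), of "snd c p"]) (rule that)
  have \<beta>_support: "x \<in> cball (snd c p) e" if "\<beta> x \<noteq> 0" for x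
    using \<beta>(3)[of x] that by fastforce
  define K where "K = {q \<in> fst c. snd c q \<in> cball (snd c p) e}"
  \<comment> \<open>\<open>K\<close> contains all points of the chart domain where the bump is
    nonzero. It is compact because the chart is a homeomorphism, hence closed in the whole Hausdorff
    space; its complement is therefore an open set on which the field vanishes.\<close>
  have "closedin X K"
  proof -
    have "compactin (top_of_set (snd c ` fst c)) (cball (snd c p) e)"
      using e(2) by (simp add: compactin_subtopology)
    moreover have "snd c ` K = cball (snd c p) e"
      using e(2) by (auto simp: K_def)
    moreover have "K \<subseteq> topspace (subtopology X (fst c))"
      using chart_subset[OF c(1)] by (auto simp: K_def)
    ultimately have "compactin (subtopology X (fst c)) K"
      using homeomorphic_map_compactness[OF homeomorphic_map_chart[OF c(1)]] by metis
    then have "compactin X K"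
      by (simp add: compactin_subtopology)
    then show ?thesis
      using smooth_manifold compactin_imp_closedin by (auto simp: smooth_manifold_def)
  qed
  define w where "w = v c"
  define V where "V q = (if q \<in> fst c then \<beta> (snd c q) *\<^sub>R tangent_vector c q w else 0)" for q
  have V_p: "V p = v"
    using c \<beta>(2) assms(2) by (simp add: V_def w_def tangent_vector_eq)
  have V_mem: "V q \<in> tangent_space A q" for q
    using subspace_scale[OF subspace_tangent_space tangent_vector_mem[OF c(1)]]
      subspace_0[OF subspace_tangent_space]
    by (simp add: V_def)
  have "\<exists>a. (\<forall>i\<in>UNIV. smooth_function A (topspace X \<inter> fst d) (a i)) \<and>
      (\<forall>q\<in>topspace X \<inter> fst d. V q = (\<Sum>i\<in>UNIV. a i q *\<^sub>R coord_field A d i q))"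
    if d: "d \<in> A" for d
  proof (intro exI conjI ballI)
    \<comment> \<open>The coefficients from \<open>tangent_vector_change\<close>, scaled by the bump
      and set to 0 outside the domain of \<open>c\<close>.\<close>
    define a where "a i q = (if q \<in> fst c then \<beta> (snd c q) * (D c d q w) $ i else 0)" for i q
    show "V q = (\<Sum>i\<in>UNIV. a i q *\<^sub>R coord_field A d i q)" if "q \<in> topspace X \<inter> fst d" for q
      using that c(1) d
      by (simp add: V_def a_def tangent_vector_change[of c d] scaleR_sum_right)
    show "smooth_function A (topspace X \<inter> fst d) (a i)" for i
      unfolding smooth_function_def smooth_on_def
    proof (intro ballI allI)
      fix c' k assume c': "c' \<in> A"
      \<comment> \<open>These two open sets cover the coordinate image in question. On
        \<open>?O1\<close> the chart \<open>c\<close> is available and the coefficient is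
        \<open>?g\<close> after a coordinate change; on \<open>?O2\<close>, which avoids
        \<open>K\<close>, it is identically 0.\<close>
      let ?O1 = "snd c' ` (fst c \<inter> fst d \<inter> fst c')"
      let ?O2 = "snd c' ` ((topspace X - K) \<inter> fst d \<inter> fst c')"
      have open1: "open ?O1"
        by (intro open_chart_image openin_Int openin_chart c' c(1) d) auto
      have open2: "open ?O2"
        using \<open>closedin X K\<close>
        by (intro open_chart_image openin_Int openin_chart c' c(1) d) auto
      let ?g = "\<lambda>z. \<beta> z * (frechet_derivative (transition c d) (at z) w) $ i"
      have "C_k_on k (snd c ` (fst c \<inter> fst d)) ?g"
      proof (rule bounded_bilinear.C_k_on[OF bounded_bilinear_mult])
        show "C_k_on k (snd c ` (fst c \<inter> fst d)) \<beta>"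
          using \<beta>(1) by (auto simp: smooth_on_def intro: C_k_on_subset)
        \<comment> \<open>The transition map is of class \<open>Suc k\<close>, so its derivative in
          the fixed direction \<open>w\<close> is of class \<open>k\<close>.\<close>
        show "C_k_on k (snd c ` (fst c \<inter> fst d)) (\<lambda>z. (frechet_derivative (transition c d) (at z) w) $ i)"
          using C_k_on_transition[OF c(1) d, of "Suc k"] open_chart_overlap[OF c(1) d]
          by (intro C_k_on_compose[OF _ _ C_k_on_bounded_linear[OF bounded_linear_vec_nth, of _ UNIV]]) auto
      qed (rule open_chart_overlap[OF c(1) d])
      moreover have "C_k_on k ?O1 (transition c' c)"
        using C_k_on_transition[OF c' c(1)] by (rule C_k_on_subset) auto
      ultimately have "C_k_on k ?O1 (\<lambda>y. ?g (transition c' c y))"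
        by (intro C_k_on_compose[OF open1, where g="?g"]) (use c' in auto)
      then have "C_k_on k ?O1 (a i \<circ> inv_into (fst c') (snd c'))"
        by (rule C_k_on_cong[OF open1, rotated]) (use c' in \<open>auto simp: a_def\<close>)
      moreover have "C_k_on k ?O2 (a i \<circ> inv_into (fst c') (snd c'))"
        by (rule C_k_on_cong[OF open2 _ C_k_on_const[where c=0]])
          (use c' in \<open>auto simp: a_def K_def dest!: \<beta>_support\<close>)
      moreover have "snd c' ` (topspace X \<inter> fst d \<inter> fst c') = ?O1 \<union> ?O2"
        using chart_subset[OF c(1)] by (auto simp: K_def)
      ultimately show "C_k_on k (snd c' ` (topspace X \<inter> fst d \<inter> fst c')) (a i \<circ> inv_into (fst c') (snd c'))"
        using C_k_on_Un[OF open1 open2] by simp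
    qed
  qed
  then have "vector_field X A V"
    using V_mem unfolding vector_field_def smooth_section_def coord_frames_def by simp
  then show thesis using V_p by (rule that)
qed

end

section \<open>Orthonormal bases of subspaces\<close>

lemma linear_on_sum:
  assumes "subspace S" "linear_on S f" "\<And>i. i \<in> I \<Longrightarrow> x i \<in> S"
  shows "f (\<Sum>i\<in>I. c i *\<^sub>R x i) = (\<Sum>i\<in>I. c i *\<^sub>R f (x i))"
proof -
  have "f 0 = 0"
    using assms(1,2) subspace_0[of S] unfolding linear_on_def by (metis scale_zero_left)
  then show ?thesis
    using assms(3)
  proof (induction I rule: infinite_finite_induct)
    case (insert j I)
    then have "(\<Sum>i\<in>I. c i *\<^sub>R x i) \<in> S" "c j *\<^sub>R x j \<in> S" "x j \<in> S"
      using assms(1) by (auto intro: subspace_sum subspace_scale)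
    then show ?case
      using insert assms(2) by (simp add: linear_on_def)
  qed auto
qed

lemma symmetric_bilinear_on_subset:
  "symmetric_bilinear_on S b \<Longrightarrow> P \<subseteq> S \<Longrightarrow> symmetric_bilinear_on P b"
  by (auto simp: symmetric_bilinear_on_def linear_on_def subset_iff)

lemma symmetric_bilinear_on_commute:
  "symmetric_bilinear_on S b \<Longrightarrow> x \<in> S \<Longrightarrow> y \<in> S \<Longrightarrow> b x y = b y x"
  by (auto simp: symmetric_bilinear_on_def)

lemma symmetric_bilinear_on_linear_right:
  "symmetric_bilinear_on S b \<Longrightarrow> x \<in> S \<Longrightarrow> linear_on S (b x)"
  by (simp add: symmetric_bilinear_on_def)

lemma symmetric_bilinear_on_linear_left:
  "symmetric_bilinear_on S b \<Longrightarrow> y \<in> S \<Longrightarrow> subspace S \<Longrightarrow> linear_on S (\<lambda>x. b x y)"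
  by (simp add: symmetric_bilinear_on_def linear_on_def subspace_add subspace_scale)

section \<open>Orthonormal systems: expansion, traces and Gram-Schmidt\<close>

locale inner_product_subspace =
  fixes S :: "'v::real_vector set" and h :: "'v \<Rightarrow> 'v \<Rightarrow> real"
  assumes subspace_S: "subspace S" and inner_product: "inner_product_on S h"
begin

lemma sym_bilinear: "symmetric_bilinear_on S h"
  using inner_product by (simp add: inner_product_on_def)

lemmas h_commute = symmetric_bilinear_on_commute[OF sym_bilinear]
  and linear_right = symmetric_bilinear_on_linear_right[OF sym_bilinear]
  and linear_left = symmetric_bilinear_on_linear_left[OF sym_bilinear _ subspace_S]

lemma h_add_left: "x \<in> S \<Longrightarrow> y \<in> S \<Longrightarrow> z \<in> S \<Longrightarrow> h (x + y) z = h x z + h y z"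
  using linear_left by (simp add: linear_on_def)

lemma h_scale_left: "x \<in> S \<Longrightarrow> z \<in> S \<Longrightarrow> h (c *\<^sub>R x) z = c * h x z"
  using linear_left by (simp add: linear_on_def)

lemma h_scale_right: "x \<in> S \<Longrightarrow> z \<in> S \<Longrightarrow> h z (c *\<^sub>R x) = c * h z x"
  using linear_right by (simp add: linear_on_def)

lemma h_zero_left: "z \<in> S \<Longrightarrow> h 0 z = 0"
  using h_scale_left[of 0 z 0] subspace_0[OF subspace_S] by simp

lemma h_sum_left:
  "(\<And>i. i \<in> I \<Longrightarrow> x i \<in> S) \<Longrightarrow> z \<in> S \<Longrightarrow> h (\<Sum>i\<in>I. c i *\<^sub>R x i) z = (\<Sum>i\<in>I. c i * h (x i) z)"
  using linear_on_sum[OF subspace_S linear_left, of z I x c] by simp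

text \<open>The vectors equal to their own expansion form a subspace containing every
  \<open>e i\<close>. Membership in \<open>S\<close> is carried through the span induction because
  \<open>h\<close> is known to be linear only there.\<close>

lemma orthonormal_basis_expansion:
  assumes e: "orthonormal_basis_on h P I e" and "P \<subseteq> S" "finite I" and x: "x \<in> P"
  shows "x = (\<Sum>i\<in>I. h x (e i) *\<^sub>R e i)"
proof -
  have eS: "e i \<in> S" if "i \<in> I" for i
    using e \<open>P \<subseteq> S\<close> that by (auto simp: orthonormal_basis_on_def)
  have "x \<in> span (e ` I)"
    using e x by (simp add: orthonormal_basis_on_def)
  then have "x \<in> S \<and> x = (\<Sum>i\<in>I. h x (e i) *\<^sub>R e i)"
  proof (rule span_induct)
    show "subspace {x. x \<in> S \<and> x = (\<Sum>i\<in>I. h x (e i) *\<^sub>R e i)}"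
    proof (rule subspaceI; clarsimp simp: subspace_0[OF subspace_S])
      show "(\<Sum>i\<in>I. h 0 (e i) *\<^sub>R e i) = 0"
        using eS by (simp add: h_zero_left)
    next
      fix x y assume x: "x \<in> S" "x = (\<Sum>i\<in>I. h x (e i) *\<^sub>R e i)"
        and y: "y \<in> S" "y = (\<Sum>i\<in>I. h y (e i) *\<^sub>R e i)"
      have "(\<Sum>i\<in>I. h (x + y) (e i) *\<^sub>R e i) = (\<Sum>i\<in>I. h x (e i) *\<^sub>R e i) + (\<Sum>i\<in>I. h y (e i) *\<^sub>R e i)"
        using eS x(1) y(1) by (simp add: h_add_left scaleR_add_left sum.distrib)
      then show "x + y \<in> S \<and> x + y = (\<Sum>i\<in>I. h (x + y) (e i) *\<^sub>R e i)"
        using x y subspace_add[OF subspace_S] by simp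
    next
      fix c x assume x: "x \<in> S" "x = (\<Sum>i\<in>I. h x (e i) *\<^sub>R e i)"
      have "(\<Sum>i\<in>I. h (c *\<^sub>R x) (e i) *\<^sub>R e i) = c *\<^sub>R (\<Sum>i\<in>I. h x (e i) *\<^sub>R e i)"
        using eS x(1) by (simp add: h_scale_left scaleR_sum_right)
      then show "c *\<^sub>R x \<in> S \<and> c *\<^sub>R x = (\<Sum>i\<in>I. h (c *\<^sub>R x) (e i) *\<^sub>R e i)"
        using x subspace_scale[OF subspace_S] by simp
    qed
  next
    fix x assume "x \<in> e ` I"
    then obtain j where j: "j \<in> I" "x = e j" by auto
    have "(\<Sum>i\<in>I. h x (e i) *\<^sub>R e i) = (\<Sum>i\<in>I. if i = j then e i else 0)"
      using e j by (intro sum.cong) (auto simp: orthonormal_basis_on_def)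
    then show "x \<in> S \<and> x = (\<Sum>i\<in>I. h x (e i) *\<^sub>R e i)"
      using j eS \<open>finite I\<close> by simp
  qed
  then show ?thesis by simp
qed

text \<open>Expand the first argument in the \<open>f j\<close>, exchange the sums and collect the
  \<open>e i\<close> in the second argument. Vector values are allowed so that the lemma covers both
  the trace of \<zeta> itself and real forms built from it.\<close>

lemma orthonormal_basis_trace:
  fixes b :: "'v \<Rightarrow> 'v \<Rightarrow> 'w::real_vector"
  assumes e: "orthonormal_basis_on h P I e" and f: "orthonormal_basis_on h P J f"
    and "P \<subseteq> S" "finite I" "finite J" and b: "symmetric_bilinear_on S b"
  shows "(\<Sum>i\<in>I. b (e i) (e i)) = (\<Sum>j\<in>J. b (f j) (f j))"
proof -
  have eP: "e i \<in> P" "e i \<in> S" if "i \<in> I" for i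
    using e \<open>P \<subseteq> S\<close> that by (auto simp: orthonormal_basis_on_def)
  have fP: "f j \<in> P" "f j \<in> S" if "j \<in> J" for j
    using f \<open>P \<subseteq> S\<close> that by (auto simp: orthonormal_basis_on_def)
  have "b (e i) (e i) = (\<Sum>j\<in>J. h (e i) (f j) *\<^sub>R b (f j) (e i))" if "i \<in> I" for i
    by (subst orthonormal_basis_expansion[OF f \<open>P \<subseteq> S\<close> \<open>finite J\<close> eP(1)[OF that]],
        rule linear_on_sum[OF subspace_S symmetric_bilinear_on_linear_left[OF b eP(2)[OF that] subspace_S]])
      (rule fP(2))
  then have "(\<Sum>i\<in>I. b (e i) (e i)) = (\<Sum>j\<in>J. \<Sum>i\<in>I. h (e i) (f j) *\<^sub>R b (f j) (e i))"
    by (simp add: sum.swap[of _ J I])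
  also have "\<dots> = (\<Sum>j\<in>J. b (f j) (f j))"
  proof (rule sum.cong[OF refl])
    fix j assume j: "j \<in> J"
    have "(\<Sum>i\<in>I. h (e i) (f j) *\<^sub>R b (f j) (e i)) = (\<Sum>i\<in>I. h (f j) (e i) *\<^sub>R b (f j) (e i))"
      using eP fP j h_commute by (intro sum.cong) auto
    also have "\<dots> = b (f j) (f j)"
      by (subst linear_on_sum[OF subspace_S symmetric_bilinear_on_linear_right[OF b fP(2)[OF j]], symmetric],
          rule eP(2), assumption,
          subst orthonormal_basis_expansion[OF e \<open>P \<subseteq> S\<close> \<open>finite I\<close> fP(1)[OF j], symmetric], rule refl)
    finally show "(\<Sum>i\<in>I. h (e i) (f j) *\<^sub>R b (f j) (e i)) = b (f j) (f j)" .
  qed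
  finally show ?thesis .
qed

lemma parseval:
  assumes "orthonormal_basis_on h S I e" "finite I" "x \<in> S"
  shows "h x x = (\<Sum>i\<in>I. (h x (e i))\<^sup>2)"
proof -
  have eS: "e i \<in> S" if "i \<in> I" for i
    using assms(1) that by (auto simp: orthonormal_basis_on_def)
  have "h x x = h (\<Sum>i\<in>I. h x (e i) *\<^sub>R e i) x"
    by (rule arg_cong[where f="\<lambda>y. h y x", OF orthonormal_basis_expansion[OF assms(1) subset_refl assms(2,3)]])
  also have "\<dots> = (\<Sum>i\<in>I. h x (e i) * h (e i) x)"
    using eS assms(3) by (intro h_sum_left) auto
  also have "\<dots> = (\<Sum>i\<in>I. (h x (e i))\<^sup>2)"
    using eS assms(3) h_commute by (intro sum.cong) (auto simp: power2_eq_square)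
  finally show ?thesis .
qed

text \<open>Pairing a vanishing combination with \<open>e j\<close> isolates the coefficient of
  \<open>e j\<close>.\<close>

lemma orthonormal_basis_card:
  assumes e: "orthonormal_basis_on h P I e" and "P \<subseteq> S" "finite I"
  shows "independent (e ` I)" "card (e ` I) = card I" "dim P = card I"
proof -
  have eS: "e i \<in> S" if "i \<in> I" for i
    using e \<open>P \<subseteq> S\<close> that by (auto simp: orthonormal_basis_on_def)
  have inj: "inj_on e I"
    using e by (auto simp: inj_on_def orthonormal_basis_on_def) (metis zero_neq_one)
  then show card: "card (e ` I) = card I" by (rule card_image)
  have "u v = 0" if u: "(\<Sum>v\<in>e ` I. u v *\<^sub>R v) = 0" and v: "v \<in> e ` I" for u v
  proof -
    obtain j where j: "j \<in> I" "v = e j" using v by auto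
    have "0 = h (\<Sum>i\<in>I. u (e i) *\<^sub>R e i) (e j)"
      using u j eS inj by (simp add: sum.reindex h_zero_left)
    also have "\<dots> = (\<Sum>i\<in>I. u (e i) * h (e i) (e j))"
      using eS j by (intro h_sum_left) auto
    also have "\<dots> = (\<Sum>i\<in>I. if i = j then u (e i) else 0)"
      using e j by (intro sum.cong) (auto simp: orthonormal_basis_on_def)
    finally show ?thesis using j \<open>finite I\<close> by simp
  qed
  then show "independent (e ` I)"
    using \<open>finite I\<close> by (auto simp: dependent_finite)
  then show "dim P = card I"
    using e card dim_span_eq_card_independent by (metis orthonormal_basis_on_def)
qed

text \<open>One Gram-Schmidt step: a vector outside \<open>P\<close>, minus its projection
  \<open>s\<close> onto \<open>P\<close>, is nonzero and orthogonal to \<open>P\<close>;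
  \<open>u\<close> is its normalization.\<close>

lemma orthonormal_extend_Suc:
  assumes e: "orthonormal_basis_on h P {1..j} e" and "P \<subseteq> S" "P \<noteq> S"
  obtains u where "u \<in> S" "orthonormal_basis_on h (span (insert u P)) {1..Suc j} (e(Suc j := u))"
proof -
  have eS: "e i \<in> S" "e i \<in> P" if "i \<in> {1..j}" for i
    using e \<open>P \<subseteq> S\<close> that by (auto simp: orthonormal_basis_on_def)
  have P: "P = span (e ` {1..j})" using e by (simp add: orthonormal_basis_on_def)
  then have subP: "subspace P" by simp
  obtain x where x: "x \<in> S" "x \<notin> P" using assms(2,3) by blast
  define s where "s = (\<Sum>i\<in>{1..j}. h x (e i) *\<^sub>R e i)"
  define y where "y = x + (-1) *\<^sub>R s"
  have s: "s \<in> P" unfolding s_def by (intro subspace_sum subP subspace_scale eS)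
  then have y: "y \<in> S" using x \<open>P \<subseteq> S\<close> subspace_S unfolding y_def by (blast intro: subspace_add subspace_scale)
  have "y \<noteq> 0" using s x by (auto simp: y_def)
  then have pos: "h y y > 0" using inner_product y by (simp add: inner_product_on_def)
  have orth: "h y (e i) = 0" if i: "i \<in> {1..j}" for i
  proof -
    have "h s (e i) = (\<Sum>k\<in>{1..j}. h x (e k) * h (e k) (e i))"
      unfolding s_def using eS i by (intro h_sum_left) auto
    also have "\<dots> = (\<Sum>k\<in>{1..j}. if k = i then h x (e k) else 0)"
      using e i by (intro sum.cong) (auto simp: orthonormal_basis_on_def)
    also have "\<dots> = h x (e i)" using i by simp
    finally have "h s (e i) = h x (e i)" .
    moreover have "s \<in> S" using s \<open>P \<subseteq> S\<close> by auto
    ultimately show ?thesis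
      using eS(1)[OF i] x(1) h_add_left[of x "(-1) *\<^sub>R s" "e i"] h_scale_left[of s "e i" "-1"]
        subspace_scale[OF subspace_S, of s "-1"] by (simp add: y_def)
  qed
  define u where "u = (1 / sqrt (h y y)) *\<^sub>R y"
  have u: "u \<in> S" unfolding u_def by (intro subspace_scale subspace_S y)
  have uu: "h u u = 1"
    using pos y u by (simp add: u_def h_scale_left h_scale_right)
  have ue: "h u (e i) = 0" "h (e i) u = 0" if "i \<in> {1..j}" for i
    using orth[OF that] eS(1)[OF that] y h_commute[of u "e i"] u by (auto simp: u_def h_scale_left)
  have "orthonormal_basis_on h (span (insert u P)) {1..Suc j} (e(Suc j := u))"
    unfolding orthonormal_basis_on_def
  proof (intro conjI ballI)
    have "(e(Suc j := u)) ` {1..j} = e ` {1..j}"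
      by (intro image_cong) auto
    then have img: "(e(Suc j := u)) ` {1..Suc j} = insert u (e ` {1..j})"
      by (subst atLeastAtMostSuc_conv) (simp_all only: image_insert fun_upd_same le_add1 plus_1_eq_Suc)
    show span: "span ((e(Suc j := u)) ` {1..Suc j}) = span (insert u P)"
      unfolding img P by (simp only: span_insert span_span)
    show "(e(Suc j := u)) i \<in> span (insert u P)" if "i \<in> {1..Suc j}" for i
      using that unfolding span[symmetric] by (intro span_base imageI)
    show "h ((e(Suc j := u)) i) ((e(Suc j := u)) k) = (if i = k then 1 else 0)"
      if "i \<in> {1..Suc j}" "k \<in> {1..Suc j}" for i k
      using that e uu ue by (auto simp: orthonormal_basis_on_def le_Suc_eq)
  qed
  with u show thesis by (rule that)
qed

text \<open>Gram-Schmidt steps are repeated until the span is \<open>S\<close>. They terminate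
  because an orthonormal system is independent and so has at most \<open>card B\<close>
  members.\<close>

lemma orthonormal_basis_extend:
  assumes B: "finite B" "S = span B"
    and e: "orthonormal_basis_on h P {1..j} e" and P: "P \<subseteq> S"
  obtains e' where "orthonormal_basis_on h S {1..dim S} e'" "\<And>i. i \<in> {1..j} \<Longrightarrow> e' i = e i"
proof -
  have "\<exists>k e'. orthonormal_basis_on h S {1..k} e' \<and> (\<forall>i\<in>{1..j}. e' i = e i)"
    using e P
  proof (induction "card B - j" arbitrary: P j e rule: less_induct)
    case less
    show ?case
    proof (cases "P = S")
      case True
      then show ?thesis using less.prems by auto
    next
      case False
      obtain u where u: "u \<in> S" "orthonormal_basis_on h (span (insert u P)) {1..Suc j} (e(Suc j := u))"
        using orthonormal_extend_Suc[OF less.prems False] .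
      have sub: "span (insert u P) \<subseteq> S"
        using less.prems(2) u(1) subspace_S by (intro span_minimal) auto
      \<comment> \<open>The measure \<open>card B - j\<close> is truncated and drops only while
        \<open>j < card B\<close>; independence of the enlarged system guarantees this.\<close>
      have "(e(Suc j := u)) ` {1..Suc j} \<subseteq> span B"
        using u(2) sub unfolding B(2)[symmetric] orthonormal_basis_on_def by blast
      then have "Suc j \<le> card B"
        using independent_span_bound[OF B(1) orthonormal_basis_card(1)[OF u(2) sub]]
          orthonormal_basis_card(2)[OF u(2) sub] by simp
      then obtain k e' where "orthonormal_basis_on h S {1..k} e'"
        "\<forall>i\<in>{1..Suc j}. e' i = (e(Suc j := u)) i"
        using less.hyps[OF _ u(2) sub] by (meson diff_less_mono2 lessI less_le_trans)
      then show ?thesis by (intro exI[of _ k] exI[of _ e']) auto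
    qed
  qed
  then obtain k e' where e': "orthonormal_basis_on h S {1..k} e'" "\<forall>i\<in>{1..j}. e' i = e i" by auto
  moreover have "k = dim S" using orthonormal_basis_card(3)[OF e'(1) subset_refl] by simp
  ultimately show thesis using that by auto
qed

lemma orthonormal_basis_exists:
  assumes "finite B" "S = span B"
  obtains e where "orthonormal_basis_on h S {1..dim S} e"
proof -
  \<comment> \<open>The construction starts from the empty system, indexed by the empty set
    \<open>{1..0}\<close>, whose span is the zero subspace.\<close>
  have "orthonormal_basis_on h {0} {1..0} (\<lambda>_. 0)"
    by (simp add: orthonormal_basis_on_def)
  then show thesis
    by (rule orthonormal_basis_extend[OF assms]) (use subspace_0[OF subspace_S] that in auto)
qed

end

section \<open>Basis-independent quantities of a vector-valued symmetric form\<close>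

locale vector_valued_form =
  V: inner_product_subspace V h + W: inner_product_subspace W k
  for V :: "'v::real_vector set" and h and W :: "'w::real_vector set" and k +
  fixes z :: "'v \<Rightarrow> 'v \<Rightarrow> 'w"
  assumes z: "symmetric_bilinear_on V z" and z_mem: "\<And>x y. x \<in> V \<Longrightarrow> y \<in> V \<Longrightarrow> z x y \<in> W"
begin

text \<open>With one argument of \<open>z\<close> frozen, the squared length of \<open>z\<close>
  becomes a quadratic form in the other argument, to which invariance of the trace applies.\<close>

lemma symmetric_bilinear_on_pullback:
  assumes "y \<in> V"
  shows "symmetric_bilinear_on V (\<lambda>x x'. k (z x y) (z x' y))"
  unfolding symmetric_bilinear_on_def
proof (intro conjI ballI)
  fix x assume x: "x \<in> V"
  have lin: "linear_on V (\<lambda>x'. z x' y)" "linear_on W (k (z x y))"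
    using symmetric_bilinear_on_linear_left[OF z assms V.subspace_S] W.linear_right z_mem x assms by auto
  then show "linear_on V (\<lambda>x'. k (z x y) (z x' y))"
    using z_mem assms by (simp add: linear_on_def)
  fix x' assume "x' \<in> V"
  then show "k (z x y) (z x' y) = k (z x' y) (z x y)"
    using z_mem x assms W.h_commute by simp
qed

text \<open>The basis is exchanged in one slot at a time by invariance of the trace; symmetry of
  \<open>z\<close> moves the remaining slot into position.\<close>

lemma sum_squared_norms_unique:
  assumes e: "orthonormal_basis_on h P I e" and f: "orthonormal_basis_on h P J f"
    and "P \<subseteq> V" "finite I" "finite J"
  shows "(\<Sum>i\<in>I. \<Sum>j\<in>I. k (z (e i) (e j)) (z (e i) (e j))) =
    (\<Sum>i\<in>J. \<Sum>j\<in>J. k (z (f i) (f j)) (z (f i) (f j)))"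
proof -
  have eV: "e i \<in> V" if "i \<in> I" for i
    using e that \<open>P \<subseteq> V\<close> by (auto simp: orthonormal_basis_on_def)
  have fV: "f j \<in> V" if "j \<in> J" for j
    using f that \<open>P \<subseteq> V\<close> by (auto simp: orthonormal_basis_on_def)
  have "(\<Sum>i\<in>I. \<Sum>j\<in>I. k (z (e i) (e j)) (z (e i) (e j))) =
      (\<Sum>j\<in>I. \<Sum>i\<in>I. k (z (e i) (e j)) (z (e i) (e j)))"
    by (rule sum.swap)
  also have "\<dots> = (\<Sum>j\<in>I. \<Sum>i\<in>J. k (z (f i) (e j)) (z (f i) (e j)))"
    by (intro sum.cong refl V.orthonormal_basis_trace[OF e f assms(3-5)] symmetric_bilinear_on_pullback eV)
  also have "\<dots> = (\<Sum>j\<in>I. \<Sum>i\<in>J. k (z (e j) (f i)) (z (e j) (f i)))"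
    using eV fV symmetric_bilinear_on_commute[OF z] by (intro sum.cong refl) (simp)
  also have "\<dots> = (\<Sum>i\<in>J. \<Sum>j\<in>I. k (z (e j) (f i)) (z (e j) (f i)))"
    by (rule sum.swap)
  also have "\<dots> = (\<Sum>i\<in>J. \<Sum>j\<in>J. k (z (f j) (f i)) (z (f j) (f i)))"
    by (intro sum.cong refl V.orthonormal_basis_trace[OF e f assms(3-5)] symmetric_bilinear_on_pullback fV)
  also have "\<dots> = (\<Sum>i\<in>J. \<Sum>j\<in>J. k (z (f i) (f j)) (z (f i) (f j)))"
    by (rule sum.swap)
  finally show ?thesis .
qed

text \<open>Parseval in \<open>W\<close>. As the left side does not mention \<open>\<xi>\<close>,
  the sum of squared components is also independent of the orthonormal basis of
  \<open>W\<close>.\<close>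

lemma sum_squared_norms_components:
  assumes e: "orthonormal_basis_on h P I e" and \<xi>: "orthonormal_basis_on k W J \<xi>"
    and "P \<subseteq> V" "finite J"
  shows "(\<Sum>i\<in>I. \<Sum>j\<in>I. k (z (e i) (e j)) (z (e i) (e j))) =
    (\<Sum>\<alpha>\<in>J. \<Sum>i\<in>I. \<Sum>j\<in>I. (k (z (e i) (e j)) (\<xi> \<alpha>))\<^sup>2)"
proof -
  have eV: "e i \<in> V" if "i \<in> I" for i
    using e that \<open>P \<subseteq> V\<close> by (auto simp: orthonormal_basis_on_def)
  have "(\<Sum>i\<in>I. \<Sum>j\<in>I. k (z (e i) (e j)) (z (e i) (e j))) =
      (\<Sum>i\<in>I. \<Sum>j\<in>I. \<Sum>\<alpha>\<in>J. (k (z (e i) (e j)) (\<xi> \<alpha>))\<^sup>2)"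
    by (intro sum.cong refl W.parseval[OF \<xi> \<open>finite J\<close>] z_mem eV)
  also have "\<dots> = (\<Sum>i\<in>I. \<Sum>\<alpha>\<in>J. \<Sum>j\<in>I. (k (z (e i) (e j)) (\<xi> \<alpha>))\<^sup>2)"
    by (intro sum.cong refl sum.swap)
  also have "\<dots> = (\<Sum>\<alpha>\<in>J. \<Sum>i\<in>I. \<Sum>j\<in>I. (k (z (e i) (e j)) (\<xi> \<alpha>))\<^sup>2)"
    by (rule sum.swap)
  finally show ?thesis .
qed

text \<open>\<open>R x y\<close> stands for T(x,y,y,x). Summing the Gauss equation gives the squared
  length of the trace of \<open>z\<close> minus the squared norm of \<open>z\<close>. Both are
  invariant, so a sum formed in the frame \<open>f\<close> can be evaluated in another frame
  \<open>e\<close> and any \<open>\<xi>\<close>.\<close>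

lemma double_scalar_curvature_components:
  assumes gauss: "\<And>x y. x \<in> V \<Longrightarrow> y \<in> V \<Longrightarrow> R x y = k (z x x) (z y y) - k (z x y) (z y x)"
    and e: "orthonormal_basis_on h V I e" and f: "orthonormal_basis_on h V I' f"
    and \<xi>: "orthonormal_basis_on k W J \<xi>" and fin: "finite I" "finite I'" "finite J"
  shows "(\<Sum>i\<in>I'. \<Sum>j\<in>I'. R (f i) (f j)) =
    (\<Sum>\<alpha>\<in>J. (\<Sum>i\<in>I. k (z (e i) (e i)) (\<xi> \<alpha>))\<^sup>2 - (\<Sum>i\<in>I. \<Sum>j\<in>I. (k (z (e i) (e j)) (\<xi> \<alpha>))\<^sup>2))"
proof -
  have eV: "e i \<in> V" if "i \<in> I" for i
    using e that by (auto simp: orthonormal_basis_on_def)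
  have fV: "f i \<in> V" if "i \<in> I'" for i
    using f that by (auto simp: orthonormal_basis_on_def)
  have \<xi>W: "\<xi> \<alpha> \<in> W" if "\<alpha> \<in> J" for \<alpha>
    using \<xi> that by (auto simp: orthonormal_basis_on_def)
  define H where "H = (\<Sum>i\<in>I. z (e i) (e i))"
  have Hf: "H = (\<Sum>i\<in>I'. z (f i) (f i))"
    unfolding H_def by (rule V.orthonormal_basis_trace[OF e f subset_refl fin(1,2) z])
  have HW: "H \<in> W" unfolding H_def by (intro subspace_sum W.subspace_S z_mem eV)
  have k_sum_e: "k H w = (\<Sum>i\<in>I. k (z (e i) (e i)) w)" if "w \<in> W" for w
    using W.h_sum_left[of I "\<lambda>i. z (e i) (e i)" w "\<lambda>_. 1"] z_mem eV that by (simp add: H_def)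
  have k_sum_f: "k H w = (\<Sum>i\<in>I'. k (z (f i) (f i)) w)" if "w \<in> W" for w
    using W.h_sum_left[of I' "\<lambda>i. z (f i) (f i)" w "\<lambda>_. 1"] z_mem fV that by (simp add: Hf)
  have "(\<Sum>i\<in>I'. \<Sum>j\<in>I'. k (z (f i) (f i)) (z (f j) (f j))) = (\<Sum>i\<in>I'. k H (z (f i) (f i)))"
    using k_sum_f z_mem fV W.h_commute by (intro sum.cong refl) simp
  also have "\<dots> = (\<Sum>i\<in>I'. k (z (f i) (f i)) H)"
    using HW z_mem fV W.h_commute by (intro sum.cong refl) simp
  also have "\<dots> = k H H"
    using k_sum_f[OF HW] by simp
  also have "\<dots> = (\<Sum>\<alpha>\<in>J. (\<Sum>i\<in>I. k (z (e i) (e i)) (\<xi> \<alpha>))\<^sup>2)"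
    using W.parseval[OF \<xi> fin(3) HW] k_sum_e[OF \<xi>W] by simp
  finally have trace: "(\<Sum>i\<in>I'. \<Sum>j\<in>I'. k (z (f i) (f i)) (z (f j) (f j))) =
      (\<Sum>\<alpha>\<in>J. (\<Sum>i\<in>I. k (z (e i) (e i)) (\<xi> \<alpha>))\<^sup>2)" .
  have "(\<Sum>i\<in>I'. \<Sum>j\<in>I'. R (f i) (f j)) =
      (\<Sum>i\<in>I'. \<Sum>j\<in>I'. k (z (f i) (f i)) (z (f j) (f j)) - k (z (f i) (f j)) (z (f i) (f j)))"
    using gauss fV symmetric_bilinear_on_commute[OF z] by (intro sum.cong refl) simp
  then show ?thesis
    using sum_squared_norms_unique[OF f e subset_refl fin(2,1)]
      sum_squared_norms_components[OF e \<xi> subset_refl fin(3)] trace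
    by (simp add: sum_subtractf)
qed

end

section \<open>The quadratic inequality\<close>

text \<open>Each induction step adds a last row and a last column, which are equal by
  symmetry.\<close>

lemma double_sum_upper_triangle:
  fixes f :: "nat \<Rightarrow> nat \<Rightarrow> real"
  assumes "\<And>i j. i \<in> {1..n} \<Longrightarrow> j \<in> {1..n} \<Longrightarrow> f i j = f j i" "\<And>i. i \<in> {1..n} \<Longrightarrow> f i i = 0"
  shows "2 * (\<Sum>i\<in>{1..n}. \<Sum>j\<in>{i<..n}. f i j) = (\<Sum>i\<in>{1..n}. \<Sum>j\<in>{1..n}. f i j)"
  using assms
proof (induction n)
  case (Suc n)
  have "(\<Sum>j\<in>{i<..Suc n}. f i j) = (\<Sum>j\<in>{i<..n}. f i j) + f i (Suc n)" if "i \<in> {1..n}" for i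
  proof -
    have "{i<..Suc n} = insert (Suc n) {i<..n}" using that by auto
    then show ?thesis by simp
  qed
  moreover have "(\<Sum>j\<in>{1..n}. f (Suc n) j) = (\<Sum>i\<in>{1..n}. f i (Suc n))"
    using Suc.prems(1) by (intro sum.cong) auto
  moreover have "2 * (\<Sum>i\<in>{1..n}. \<Sum>j\<in>{i<..n}. f i j) = (\<Sum>i\<in>{1..n}. \<Sum>j\<in>{1..n}. f i j)"
    using Suc.prems by (intro Suc.IH) auto
  ultimately show ?case
    using Suc.prems(2)[of "Suc n"] by (simp add: sum.distrib)
qed simp

text \<open>Write \<open>x i\<close> as the deviation \<open>x i - c * y\<close> plus
  \<open>c * y\<close>. The hypotheses make \<open>A * c\<close> equal to
  \<open>1 + real (card I) * c\<close>, and with this the terms mixing deviations with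
  \<open>y\<close> and the pure \<open>y\<^sup>2\<close> terms both cancel.\<close>

lemma weighted_square_identity:
  fixes x :: "'i \<Rightarrow> real"
  assumes "A * c = B" "B = 1 + real (card I) * c"
  shows "A * (\<Sum>i\<in>I. (x i)\<^sup>2) + B * y\<^sup>2 - ((\<Sum>i\<in>I. x i) + y)\<^sup>2 =
    A * (\<Sum>i\<in>I. (x i - c * y)\<^sup>2) - (\<Sum>i\<in>I. x i - c * y)\<^sup>2"
proof -
  let ?k = "real (card I)" and ?s = "\<Sum>i\<in>I. x i" and ?q = "\<Sum>i\<in>I. (x i)\<^sup>2"
  have "(\<Sum>i\<in>I. (x i - c * y)\<^sup>2) = ?q - 2 * (c * y) * ?s + ?k * (c * y)\<^sup>2"
    by (simp add: power2_diff sum.distrib sum_subtractf sum_distrib_left sum_distrib_right mult_ac)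
  then have "A * (\<Sum>i\<in>I. (x i - c * y)\<^sup>2) = A * ?q - 2 * (A * c) * y * ?s + (A * c) * (?k * c) * y\<^sup>2"
    by (simp only:) (simp add: power2_eq_square algebra_simps)
  also have "\<dots> = A * ?q - 2 * (1 + ?k * c) * y * ?s + (1 + ?k * c) * (?k * c) * y\<^sup>2"
    by (simp only: assms)
  finally have "A * (\<Sum>i\<in>I. (x i - c * y)\<^sup>2) =
      A * ?q - 2 * (1 + ?k * c) * y * ?s + (1 + ?k * c) * (?k * c) * y\<^sup>2" .
  moreover have "(\<Sum>i\<in>I. x i - c * y) = ?s - ?k * (c * y)"
    by (simp add: sum_subtractf)
  ultimately show ?thesis
    unfolding assms(2) by (simp only:) (simp add: power2_eq_square algebra_simps)
qed

text \<open>Cauchy-Schwarz for the deviations. The margin \<open>A - real (card I)\<close>, positive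
  in the application, is what later settles the equality case.\<close>

lemma weighted_square_gap:
  fixes x :: "'i \<Rightarrow> real"
  assumes "A * c = B" "B = 1 + real (card I) * c"
  shows "(A - real (card I)) * (\<Sum>i\<in>I. (x i - c * y)\<^sup>2) \<le>
    A * (\<Sum>i\<in>I. (x i)\<^sup>2) + B * y\<^sup>2 - ((\<Sum>i\<in>I. x i) + y)\<^sup>2"
  unfolding weighted_square_identity[OF assms]
  using sum_squared_le_sum_of_squares[of "\<lambda>i. x i - c * y" I]
  by (simp add: algebra_simps)

text \<open>The contribution of one normal direction, with second fundamental form \<open>z\<close>, to
  \<open>r \<C> + a(r) \<C>(\<Pi>) - 2\<tau>\<close>, where the hyperplane \<open>\<Pi>\<close> is spanned by the first \<open>n - 1\<close> basis
  vectors.\<close>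

definition casorati_gap :: "nat \<Rightarrow> real \<Rightarrow> (nat \<Rightarrow> nat \<Rightarrow> real) \<Rightarrow> real" where
  "casorati_gap n r z =
    r * (1 / real n * (\<Sum>i\<in>{1..n}. \<Sum>j\<in>{1..n}. (z i j)\<^sup>2)) +
    coeff_a n r * (1 / real (n - 1) * (\<Sum>i\<in>{1..n-1}. \<Sum>j\<in>{1..n-1}. (z i j)\<^sup>2)) -
    ((\<Sum>i\<in>{1..n}. z i i)\<^sup>2 - (\<Sum>i\<in>{1..n}. \<Sum>j\<in>{1..n}. (z i j)\<^sup>2))"

lemma casorati_gap:
  assumes n: "2 \<le> n" and r: "0 < r"
  shows "0 \<le> casorati_gap n r z"
    and "casorati_gap n r z = 0 \<longleftrightarrow>
      (\<forall>i\<in>{1..n}. \<forall>j\<in>{1..n}. i \<noteq> j \<longrightarrow> z i j = 0) \<and>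
      (\<forall>i\<in>{1..n-1}. z i i = r / (real n * (real n - 1)) * z n n)"
proof -
  \<comment> \<open>In this proof \<open>m\<close> is n - 1, the dimension of the
    hyperplane.\<close>
  obtain m where m: "n = Suc m" using n by (cases n) auto
  have m0: "real m > 0" using m n by simp
  have n0: "real n > 0" "real n = real m + 1" using m by simp_all
  \<comment> \<open>\<open>B\<close> is 1 + r/n, the weight of each squared component in r C -
    2\<tau>; \<open>A\<close> is \<open>B\<close> plus a(r)/(n - 1), the weight of the components
    inside the hyperplane block. Then \<open>c\<close> is \<open>B / A\<close>, the ratio in the
    equality condition.\<close>
  define A where "A = (real n + r) * real m / r"
  define B where "B = (real n + r) / real n"
  define c where "c = r / (real n * real m)"
  have AB: "A * c = B" "B = 1 + real (card {1..m}) * c"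
    using m0 n0(1) r by (simp_all add: A_def B_def c_def add_divide_distrib)
  have A: "A - real m = real n * real m / r"
    using r by (simp add: A_def field_simps)
  have pos: "0 < real n * real m / r" "A > 0" "B > 0"
    using m0 n0(1) r by (simp_all add: A_def B_def add_pos_pos)
  have coeff: "coeff_a n r * (1 / real m) = A - B"
    using m0 n0(1) r unfolding coeff_a_def A_def B_def
    by (simp add: divide_simps) (simp add: n0(2) algebra_simps power2_eq_square)
  \<comment> \<open>The block sum \<open>S\<close> splits into its off-diagonal part
    \<open>Off\<close> and its diagonal; \<open>Cross\<close> collects the last row and column
    without the corner. The squared trace involves diagonal entries alone, so it enters only
    \<open>Q\<close>, and \<open>E\<close> measures the failure of the equality condition
    there.\<close>
  define S where "S = (\<Sum>i\<in>{1..m}. \<Sum>j\<in>{1..m}. (z i j)\<^sup>2)"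
  define Off where "Off = (\<Sum>i\<in>{1..m}. \<Sum>j\<in>{1..m}. if i = j then 0 else (z i j)\<^sup>2)"
  define Cross where "Cross = (\<Sum>i\<in>{1..m}. (z i n)\<^sup>2) + (\<Sum>i\<in>{1..m}. (z n i)\<^sup>2)"
  define Q where "Q = A * (\<Sum>i\<in>{1..m}. (z i i)\<^sup>2) + B * (z n n)\<^sup>2 - ((\<Sum>i\<in>{1..m}. z i i) + z n n)\<^sup>2"
  define E where "E = (\<Sum>i\<in>{1..m}. (z i i - c * z n n)\<^sup>2)"
  have S: "S = Off + (\<Sum>i\<in>{1..m}. (z i i)\<^sup>2)"
  proof -
    have "(\<Sum>j\<in>{1..m}. (z i j)\<^sup>2) = (\<Sum>j\<in>{1..m}. if i = j then 0 else (z i j)\<^sup>2) + (z i i)\<^sup>2"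
      if "i \<in> {1..m}" for i
    proof -
      have "(\<Sum>j\<in>{1..m}. (z i j)\<^sup>2) =
          (\<Sum>j\<in>{1..m}. (if i = j then 0 else (z i j)\<^sup>2) + (if i = j then (z i j)\<^sup>2 else 0))"
        by (intro sum.cong) auto
      then show ?thesis using that by (simp add: sum.distrib)
    qed
    then show ?thesis by (simp add: S_def Off_def sum.distrib)
  qed
  have full: "(\<Sum>i\<in>{1..n}. \<Sum>j\<in>{1..n}. (z i j)\<^sup>2) = S + Cross + (z n n)\<^sup>2"
    by (simp add: m S_def Cross_def sum.distrib)
  have tr: "(\<Sum>i\<in>{1..n}. z i i) = (\<Sum>i\<in>{1..m}. z i i) + z n n"
    by (simp add: m)
  have r_n: "r * (1 / real n * t) + t = B * t" for t
    using m by (simp add: B_def field_simps)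
  have "casorati_gap n r z = (r * (1 / real n * (S + Cross + (z n n)\<^sup>2)) + (S + Cross + (z n n)\<^sup>2)) +
      coeff_a n r * (1 / real m) * S - ((\<Sum>i\<in>{1..m}. z i i) + z n n)\<^sup>2"
    unfolding casorati_gap_def full tr by (simp add: m S_def)
  then have gap: "casorati_gap n r z = A * Off + B * Cross + Q"
    unfolding r_n coeff Q_def by (simp add: S algebra_simps)
  have Q: "(real n * real m / r) * E \<le> Q"
    using weighted_square_gap[OF AB, of "\<lambda>i. z i i" "z n n"] A by (simp add: Q_def E_def)
  have nonneg: "0 \<le> Off" "0 \<le> Cross" "0 \<le> E"
    unfolding Off_def Cross_def E_def by (auto intro!: sum_nonneg add_nonneg_nonneg)
  have terms: "0 \<le> A * Off" "0 \<le> B * Cross" "0 \<le> Q"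
    using nonneg pos order_trans[OF mult_nonneg_nonneg[OF less_imp_le[OF pos(1)] nonneg(3)] Q] by simp_all
  then show "0 \<le> casorati_gap n r z" by (simp add: gap)
  have Off0: "Off = 0 \<longleftrightarrow> (\<forall>i\<in>{1..m}. \<forall>j\<in>{1..m}. i \<noteq> j \<longrightarrow> z i j = 0)"
    unfolding Off_def by (subst sum_nonneg_eq_0_iff) (auto simp: sum_nonneg_eq_0_iff intro!: sum_nonneg)
  have Cross0: "Cross = 0 \<longleftrightarrow> (\<forall>i\<in>{1..m}. z i n = 0 \<and> z n i = 0)"
    unfolding Cross_def by (subst add_nonneg_eq_0_iff) (auto simp: sum_nonneg_eq_0_iff intro!: sum_nonneg)
  have E0: "E = 0 \<longleftrightarrow> (\<forall>i\<in>{1..m}. z i i = c * z n n)"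
    unfolding E_def by (subst sum_nonneg_eq_0_iff) auto
  \<comment> \<open>One direction uses the lower bound of \<open>Q\<close> by a positive multiple of
    \<open>E\<close>; in the other all deviations vanish, and so does the completed square.\<close>
  have Q0: "Q = 0 \<longleftrightarrow> E = 0"
  proof
    assume "Q = 0"
    then have "(real n * real m / r) * E \<le> 0" using Q by simp
    then have "E \<le> 0"
      unfolding mult_le_0_iff using pos(1) by argo
    then show "E = 0" using nonneg(3) by simp
  next
    assume "E = 0"
    then have "\<forall>i\<in>{1..m}. z i i - c * z n n = 0" using E0 by simp
    then show "Q = 0"
      unfolding Q_def weighted_square_identity[OF AB] by simp
  qed
  have "casorati_gap n r z = 0 \<longleftrightarrow> Off = 0 \<and> Cross = 0 \<and> E = 0"
    using terms pos Q0 by (auto simp: gap add_nonneg_eq_0_iff)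
  also have "\<dots> \<longleftrightarrow> (\<forall>i\<in>{1..n}. \<forall>j\<in>{1..n}. i \<noteq> j \<longrightarrow> z i j = 0) \<and> (\<forall>i\<in>{1..m}. z i i = c * z n n)"
    unfolding Off0 Cross0 E0 m by (auto simp: le_Suc_eq)
  finally show "casorati_gap n r z = 0 \<longleftrightarrow>
      (\<forall>i\<in>{1..n}. \<forall>j\<in>{1..n}. i \<noteq> j \<longrightarrow> z i j = 0) \<and>
      (\<forall>i\<in>{1..n-1}. z i i = r / (real n * (real n - 1)) * z n n)"
    by (simp add: m c_def)
qed

section \<open>Casorati curvatures at a point\<close>

text \<open>The given \<open>e\<close> and \<open>\<xi>\<close> show that the choices in the
  definition of \<open>casorati\<close> do yield orthonormal bases, and invariance of the sum of
  squares removes the dependence on them.\<close>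

lemma casorati_components:
  assumes "vector_valued_form V (g p) (F p) (gB p) (\<zeta> p)" and "P \<subseteq> V"
    and e: "orthonormal_basis_on (g p) P {1..dim P} e"
    and \<xi>: "orthonormal_basis_on (gB p) (F p) {n+1..m} \<xi>"
  shows "casorati n m g F gB \<zeta> p P =
    1 / real (dim P) * (\<Sum>\<alpha>\<in>{n+1..m}. \<Sum>i\<in>{1..dim P}. \<Sum>j\<in>{1..dim P}. (gB p (\<zeta> p (e i) (e j)) (\<xi> \<alpha>))\<^sup>2)"
proof -
  interpret vector_valued_form V "g p" "F p" "gB p" "\<zeta> p" by fact
  define e' where "e' = (SOME e. orthonormal_basis_on (g p) P {1..dim P} e)"
  define \<xi>' where "\<xi>' = (SOME \<xi>. orthonormal_basis_on (gB p) (F p) {n+1..m} \<xi>)"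
  have e': "orthonormal_basis_on (g p) P {1..dim P} e'"
    unfolding e'_def by (rule someI[where P="orthonormal_basis_on (g p) P {1..dim P}", OF e])
  have \<xi>': "orthonormal_basis_on (gB p) (F p) {n+1..m} \<xi>'"
    unfolding \<xi>'_def by (rule someI[where P="orthonormal_basis_on (gB p) (F p) {n+1..m}", OF \<xi>])
  have "(\<Sum>\<alpha>\<in>{n+1..m}. \<Sum>i\<in>{1..dim P}. \<Sum>j\<in>{1..dim P}. (gB p (\<zeta> p (e' i) (e' j)) (\<xi>' \<alpha>))\<^sup>2) =
      (\<Sum>\<alpha>\<in>{n+1..m}. \<Sum>i\<in>{1..dim P}. \<Sum>j\<in>{1..dim P}. (gB p (\<zeta> p (e i) (e j)) (\<xi> \<alpha>))\<^sup>2)"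
    using sum_squared_norms_unique[OF e' e \<open>P \<subseteq> V\<close>]
      sum_squared_norms_components[OF e' \<xi>' \<open>P \<subseteq> V\<close>] sum_squared_norms_components[OF e \<xi> \<open>P \<subseteq> V\<close>]
    by simp
  then show ?thesis
    by (simp only: casorati_def Let_def e'_def[symmetric] \<xi>'_def[symmetric])
qed

text \<open>Isolates the linear algebra at one point. \<open>gauss\<close> is the Gauss equation for
  the arguments x, y, y, x that enter the scalar curvature, already stated for tangent
  vectors.\<close>

locale gauss_point =
  vector_valued_form "tangent_space A p" "g p" "F p" "gB p" "\<zeta> p"
  for A :: "('m, 'n::finite) chart set" and p g and F :: "'m \<Rightarrow> 'v::real_vector set" and gB \<zeta> +
  fixes T :: "'m \<Rightarrow> (('m, 'n) chart \<Rightarrow> real ^ 'n) \<Rightarrow> (('m, 'n) chart \<Rightarrow> real ^ 'n) \<Rightarrow>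
                (('m, 'n) chart \<Rightarrow> real ^ 'n) \<Rightarrow> (('m, 'n) chart \<Rightarrow> real ^ 'n) \<Rightarrow> real"
    and n m :: nat
  assumes card_n: "CARD('n) = n"
    and tangent_basis: "\<exists>B. finite B \<and> independent B \<and> span B = tangent_space A p \<and> card B = n"
    and fibre_basis: "\<exists>B. finite B \<and> independent B \<and> span B = F p \<and> card B = m - n"
    and dim_ge_2: "2 \<le> n"
    and gauss: "\<And>x y. x \<in> tangent_space A p \<Longrightarrow> y \<in> tangent_space A p \<Longrightarrow>
      T p x y y x = gB p (\<zeta> p x x) (\<zeta> p y y) - gB p (\<zeta> p x y) (\<zeta> p y x)"
begin

abbreviation \<C> where "\<C> P \<equiv> casorati n m g F gB \<zeta> p P"

text \<open>Undoing the normalization leaves 2\<tau>.\<close>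

abbreviation double_tau :: real where
  "double_tau \<equiv> real n * (real n - 1) * normalized_scalar_curvature A g T p"

abbreviation gap where
  "gap r e \<xi> \<alpha> \<equiv> casorati_gap n r (\<lambda>i j. gB p (\<zeta> p (e i) (e j)) (\<xi> \<alpha>))"

abbreviation tangent_frame where
  "tangent_frame e \<equiv> orthonormal_basis_on (g p) (tangent_space A p) {1..n} e"

abbreviation fibre_frame where
  "fibre_frame \<xi> \<equiv> orthonormal_basis_on (gB p) (F p) {n+1..m} \<xi>"

lemma dim_tangent_space: "dim (tangent_space A p) = n"
  using tangent_basis dim_span_eq_card_independent by metis

lemma fibre_frame_exists: "\<exists>\<xi>. fibre_frame \<xi>"
proof -
  obtain B where B: "finite B" "independent B" "span B = F p" "card B = m - n"
    using fibre_basis by blast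
  obtain \<eta> where \<eta>: "orthonormal_basis_on (gB p) (F p) {1..dim (F p)} \<eta>"
    using W.orthonormal_basis_exists[OF B(1) B(3)[symmetric]] by blast
  have "dim (F p) = m - n" using dim_span_eq_card_independent[OF B(2)] B(3,4) by simp
  with \<eta> have \<eta>: "orthonormal_basis_on (gB p) (F p) {1..m - n} \<eta>" by simp
  have mem: "\<alpha> - n \<in> {1..m - n}" if "\<alpha> \<in> {n+1..m}" for \<alpha> using that by auto
  \<comment> \<open>Existence is known for the index set \<open>{1..m - n}\<close>; subtracting
    \<open>n\<close> translates the required indices \<open>{n+1..m}\<close> to it. Both sets are
    empty when \<open>m = n\<close>.\<close>
  have img: "(\<lambda>\<alpha>. \<eta> (\<alpha> - n)) ` {n+1..m} = \<eta> ` {1..m - n}"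
  proof -
    have "(\<lambda>\<alpha>. \<alpha> - n) ` {n+1..m} = {1..m - n}"
    proof (intro equalityI subsetI)
      fix i assume "i \<in> {1..m - n}"
      then show "i \<in> (\<lambda>\<alpha>. \<alpha> - n) ` {n+1..m}" by (intro image_eqI[of _ _ "i + n"]) auto
    qed auto
    then show ?thesis by (metis image_image)
  qed
  have "fibre_frame (\<lambda>\<alpha>. \<eta> (\<alpha> - n))"
    unfolding orthonormal_basis_on_def img
  proof (intro conjI ballI)
    show "\<eta> (\<alpha> - n) \<in> F p" if "\<alpha> \<in> {n+1..m}" for \<alpha>
      using \<eta> mem[OF that] by (simp add: orthonormal_basis_on_def)
    show "gB p (\<eta> (\<alpha> - n)) (\<eta> (\<beta> - n)) = (if \<alpha> = \<beta> then 1 else 0)"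
      if "\<alpha> \<in> {n+1..m}" "\<beta> \<in> {n+1..m}" for \<alpha> \<beta>
      using \<eta> mem[OF that(1)] mem[OF that(2)] that by (auto simp: orthonormal_basis_on_def)
    show "span (\<eta> ` {1..m - n}) = F p"
      using \<eta> by (simp add: orthonormal_basis_on_def)
  qed
  then show ?thesis by blast
qed

lemma tangent_frame_exists: "\<exists>e. tangent_frame e"
  using tangent_basis V.orthonormal_basis_exists dim_tangent_space by metis

lemma double_tau_components:
  assumes e: "tangent_frame e" and \<xi>: "fibre_frame \<xi>"
  shows "double_tau = (\<Sum>\<alpha>\<in>{n+1..m}. (\<Sum>i\<in>{1..n}. gB p (\<zeta> p (e i) (e i)) (\<xi> \<alpha>))\<^sup>2 -
    (\<Sum>i\<in>{1..n}. \<Sum>j\<in>{1..n}. (gB p (\<zeta> p (e i) (e j)) (\<xi> \<alpha>))\<^sup>2))"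
proof -
  \<comment> \<open>\<open>f\<close> is the arbitrary frame picked by the definition of scalar
    curvature; the result is to be expressed in the given frame \<open>e\<close> instead.\<close>
  define f where "f = (SOME e. tangent_frame e)"
  have f: "tangent_frame f" unfolding f_def by (rule someI[where P="orthonormal_basis_on (g p) (tangent_space A p) {1..n}", OF e])
  then have fV: "f i \<in> tangent_space A p" if "i \<in> {1..n}" for i
    using that by (simp add: orthonormal_basis_on_def)
  define R where "R x y = T p x y y x" for x y
  have "R (f i) (f j) = R (f j) (f i)" if "i \<in> {1..n}" "j \<in> {1..n}" for i j
  proof -
    have "\<zeta> p (f i) (f j) = \<zeta> p (f j) (f i)"
      using symmetric_bilinear_on_commute[OF z] fV that by blast
    moreover have "gB p (\<zeta> p (f i) (f i)) (\<zeta> p (f j) (f j)) = gB p (\<zeta> p (f j) (f j)) (\<zeta> p (f i) (f i))"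
      using W.h_commute z_mem fV that by blast
    ultimately show ?thesis
      using gauss fV that by (simp add: R_def)
  qed
  moreover have "R (f i) (f i) = 0" if "i \<in> {1..n}" for i
    using gauss fV that by (simp add: R_def)
  ultimately have "2 * (\<Sum>i\<in>{1..n}. \<Sum>j\<in>{i<..n}. R (f i) (f j)) = (\<Sum>i\<in>{1..n}. \<Sum>j\<in>{1..n}. R (f i) (f j))"
    by (rule double_sum_upper_triangle)
  moreover have "double_tau = 2 * (\<Sum>i\<in>{1..n}. \<Sum>j\<in>{i<..n}. R (f i) (f j))"
  proof -
    have "real n * (real n - 1) \<noteq> 0" using dim_ge_2 by auto
    then show ?thesis
      by (simp add: card_n normalized_scalar_curvature_def scalar_curvature_def Let_def f_def R_def)
  qed
  moreover have "(\<Sum>i\<in>{1..n}. \<Sum>j\<in>{1..n}. R (f i) (f j)) =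
      (\<Sum>\<alpha>\<in>{n+1..m}. (\<Sum>i\<in>{1..n}. gB p (\<zeta> p (e i) (e i)) (\<xi> \<alpha>))\<^sup>2 -
        (\<Sum>i\<in>{1..n}. \<Sum>j\<in>{1..n}. (gB p (\<zeta> p (e i) (e j)) (\<xi> \<alpha>))\<^sup>2))"
    by (rule double_scalar_curvature_components[OF _ e f \<xi>]) (simp_all add: R_def gauss)
  ultimately show ?thesis by simp
qed

lemma hyperplane_of_frame:
  assumes e: "tangent_frame e"
  shows "span (e ` {1..n-1}) \<in> hyperplanes A p"
    and "orthonormal_basis_on (g p) (span (e ` {1..n-1})) {1..dim (span (e ` {1..n-1}))} e"
    and "dim (span (e ` {1..n-1})) = n - 1"
proof -
  let ?P = "span (e ` {1..n-1})"
  have "?P \<subseteq> span (e ` {1..n})" by (intro span_mono image_mono) auto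
  then have sub: "?P \<subseteq> tangent_space A p"
    using e by (simp add: orthonormal_basis_on_def)
  have b: "orthonormal_basis_on (g p) ?P {1..n-1} e"
    using e by (auto simp: orthonormal_basis_on_def intro: span_base)
  then show dim: "dim ?P = n - 1"
    using V.orthonormal_basis_card(3)[OF b sub] by simp
  then show "orthonormal_basis_on (g p) ?P {1..dim ?P} e" using b by simp
  show "?P \<in> hyperplanes A p" using sub dim by (simp add: hyperplanes_def card_n)
qed

text \<open>An orthonormal basis of \<open>P\<close> is completed to one of the tangent space, so
  that \<open>e n\<close> becomes a unit normal of \<open>P\<close>.\<close>

lemma frame_of_hyperplane:
  assumes "P \<in> hyperplanes A p"
  obtains e where "tangent_frame e" "P = span (e ` {1..n-1})"
proof -
  have P: "subspace P" "P \<subseteq> tangent_space A p" "dim P = n - 1"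
    using assms by (auto simp: hyperplanes_def card_n)
  obtain B where B: "finite B" "tangent_space A p = span B" using tangent_basis by blast
  \<comment> \<open>Gram-Schmidt inside \<open>P\<close> requires a finite spanning set of
    \<open>P\<close>; a basis of \<open>P\<close> is finite since it is independent in the
    finite-dimensional tangent space.\<close>
  obtain C where C: "C \<subseteq> P" "independent C" "P \<subseteq> span C" "card C = dim P"
    using basis_exists[of P] .
  have "C \<subseteq> span B" using C(1) P(2) B(2) by simp
  then have "finite C" using independent_span_bound[OF B(1) C(2)] by simp
  have "P = span C" using C(3) span_minimal[OF C(1) P(1)] by (rule equalityI)
  interpret P: inner_product_subspace P "g p"
  proof
    show "inner_product_on P (g p)"
      unfolding inner_product_on_def
      using symmetric_bilinear_on_subset[OF V.sym_bilinear P(2)] V.inner_product P(2)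
      by (simp add: inner_product_on_def subset_iff)
  qed (rule P(1))
  obtain f where "orthonormal_basis_on (g p) P {1..dim P} f"
    using P.orthonormal_basis_exists[OF \<open>finite C\<close> \<open>P = span C\<close>] .
  then have f: "orthonormal_basis_on (g p) P {1..n-1} f" by (simp only: P(3))
  obtain e where e: "orthonormal_basis_on (g p) (tangent_space A p) {1..dim (tangent_space A p)} e"
      "\<And>i. i \<in> {1..n-1} \<Longrightarrow> e i = f i"
    by (rule V.orthonormal_basis_extend[OF B f P(2)]) (rule that)
  from e(1) have frame: "tangent_frame e" by (simp only: dim_tangent_space)
  have "e ` {1..n-1} = f ` {1..n-1}" using e(2) by (rule image_cong[OF refl])
  then have "P = span (e ` {1..n-1})" using f by (simp add: orthonormal_basis_on_def)
  with frame show thesis by (rule that)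
qed

lemma hyperplanes_nonempty: "hyperplanes A p \<noteq> {}"
  using tangent_frame_exists hyperplane_of_frame(1) by blast

text \<open>Evaluating both Casorati curvatures and 2\<tau> in the same adapted frames makes the
  expression split over the normal directions, one gap for each.\<close>

lemma casorati_gap_sum:
  assumes e: "tangent_frame e" and \<xi>: "fibre_frame \<xi>"
  shows "r * \<C> (tangent_space A p) + coeff_a n r * \<C> (span (e ` {1..n-1})) - double_tau =
    (\<Sum>\<alpha>\<in>{n+1..m}. gap r e \<xi> \<alpha>)"
proof -
  have vvf: "vector_valued_form (tangent_space A p) (g p) (F p) (gB p) (\<zeta> p)"
    by unfold_locales
  have "\<C> (tangent_space A p) = 1 / real n *
      (\<Sum>\<alpha>\<in>{n+1..m}. \<Sum>i\<in>{1..n}. \<Sum>j\<in>{1..n}. (gB p (\<zeta> p (e i) (e j)) (\<xi> \<alpha>))\<^sup>2)"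
    using casorati_components[of "tangent_space A p" g p F gB \<zeta> "tangent_space A p" e n m \<xi>, OF vvf]
      e \<xi> by (simp add: dim_tangent_space)
  moreover have "\<C> (span (e ` {1..n-1})) = 1 / real (n - 1) *
      (\<Sum>\<alpha>\<in>{n+1..m}. \<Sum>i\<in>{1..n-1}. \<Sum>j\<in>{1..n-1}. (gB p (\<zeta> p (e i) (e j)) (\<xi> \<alpha>))\<^sup>2)"
    using casorati_components[of "tangent_space A p" g p F gB \<zeta> _ e n m \<xi>, OF vvf _
        hyperplane_of_frame(2)[OF e] \<xi>] hyperplane_of_frame[OF e]
    by (simp add: hyperplanes_def card_n)
  ultimately show ?thesis
    unfolding double_tau_components[OF e \<xi>] casorati_gap_def
    by (simp only: sum.distrib sum_subtractf sum_distrib_left)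
qed

text \<open>Valid for every hyperplane separately, by a frame adapted to it and nonnegativity of
  each gap; the passage to an extremum comes afterwards.\<close>

lemma double_tau_le:
  assumes "0 < r" "P \<in> hyperplanes A p"
  shows "double_tau \<le> r * \<C> (tangent_space A p) + coeff_a n r * \<C> P"
proof -
  obtain e where e: "tangent_frame e" "P = span (e ` {1..n-1})"
    using frame_of_hyperplane[OF assms(2)] .
  obtain \<xi> where \<xi>: "fibre_frame \<xi>" using fibre_frame_exists by blast
  have "0 \<le> (\<Sum>\<alpha>\<in>{n+1..m}. gap r e \<xi> \<alpha>)"
    using casorati_gap(1)[OF dim_ge_2 assms(1)] by (intro sum_nonneg)
  then show ?thesis
    using casorati_gap_sum[OF e(1) \<xi>, of r] e(2) by simp
qed

lemma gap_sum_eq_0_iff: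
  assumes "0 < r"
  shows "(\<Sum>\<alpha>\<in>{n+1..m}. gap r e \<xi> \<alpha>) = 0 \<longleftrightarrow>
    (\<forall>i\<in>{1..n}. \<forall>j\<in>{1..n}. \<forall>\<alpha>\<in>{n+1..m}. i \<noteq> j \<longrightarrow> gB p (\<zeta> p (e i) (e j)) (\<xi> \<alpha>) = 0) \<and>
    (\<forall>i\<in>{1..n-1}. \<forall>\<alpha>\<in>{n+1..m}. gB p (\<zeta> p (e i) (e i)) (\<xi> \<alpha>) =
      r / (real n * (real n - 1)) * gB p (\<zeta> p (e n) (e n)) (\<xi> \<alpha>))"
proof -
  have "(\<Sum>\<alpha>\<in>{n+1..m}. gap r e \<xi> \<alpha>) = 0 \<longleftrightarrow> (\<forall>\<alpha>\<in>{n+1..m}. gap r e \<xi> \<alpha> = 0)"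
    using casorati_gap(1)[OF dim_ge_2 assms] by (intro sum_nonneg_eq_0_iff) auto
  then show ?thesis
    unfolding casorati_gap(2)[OF dim_ge_2 assms] by blast
qed

text \<open>Treats infimum and supremum together: \<open>x\<close> is the extremal value, and the
  sign of a(r) is hidden in \<open>extremal\<close>, which says that \<open>x\<close> minimizes the
  product with a(r).\<close>

lemma equality_iff:
  assumes r: "0 < r"
    and le: "double_tau \<le> r * \<C> (tangent_space A p) + coeff_a n r * x"
    and extremal: "\<And>Q. Q \<in> hyperplanes A p \<Longrightarrow> coeff_a n r * x \<le> coeff_a n r * \<C> Q"
    and attained: "P \<in> hyperplanes A p" "\<C> P = x"
  shows "double_tau = r * \<C> (tangent_space A p) + coeff_a n r * x \<longleftrightarrow>
    has_equality_form m A g F gB \<zeta> r p"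
proof
  assume eq: "double_tau = r * \<C> (tangent_space A p) + coeff_a n r * x"
  \<comment> \<open>In a frame adapted to the hyperplane attaining the extremum, the sum of the gaps
    is exactly the defect of the inequality.\<close>
  obtain e where e: "tangent_frame e" "P = span (e ` {1..n-1})"
    using frame_of_hyperplane[OF attained(1)] .
  obtain \<xi> where \<xi>: "fibre_frame \<xi>" using fibre_frame_exists by blast
  have "(\<Sum>\<alpha>\<in>{n+1..m}. gap r e \<xi> \<alpha>) = 0"
    using casorati_gap_sum[OF e(1) \<xi>, of r] eq attained(2) e(2) by simp
  then show "has_equality_form m A g F gB \<zeta> r p"
    unfolding gap_sum_eq_0_iff[OF r] has_equality_form_def card_n Let_def using e(1) \<xi> by blast
next
  assume "has_equality_form m A g F gB \<zeta> r p"
  then obtain e \<xi> where e: "tangent_frame e" and \<xi>: "fibre_frame \<xi>"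
    and "(\<Sum>\<alpha>\<in>{n+1..m}. gap r e \<xi> \<alpha>) = 0"
    unfolding gap_sum_eq_0_iff[OF r] has_equality_form_def card_n Let_def by blast
  \<comment> \<open>The hyperplane of this frame may differ from \<open>P\<close>. Equality for it,
    with \<open>extremal\<close>, bounds \<open>double_tau\<close> from below by the extremal
    expression, and \<open>le\<close> is the reverse bound.\<close>
  then have "double_tau = r * \<C> (tangent_space A p) + coeff_a n r * \<C> (span (e ` {1..n-1}))"
    using casorati_gap_sum[OF e \<xi>, of r] by simp
  then show "double_tau = r * \<C> (tangent_space A p) + coeff_a n r * x"
    using extremal[OF hyperplane_of_frame(1)[OF e]] le by linarith
qed

section \<open>Sign of the coefficient and passage to the infimum or supremum\<close>

lemma normalized_le_iff: "normalized_scalar_curvature A g T p \<le> 1 / (real n * (real n - 1)) * d \<longleftrightarrow> double_tau \<le> d"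
  and normalized_eq_iff: "normalized_scalar_curvature A g T p = 1 / (real n * (real n - 1)) * d \<longleftrightarrow> double_tau = d"
proof -
  have "real n * (real n - 1) > 0" "n \<noteq> 0" "n \<noteq> Suc 0" using dim_ge_2 by auto
  then show "normalized_scalar_curvature A g T p \<le> 1 / (real n * (real n - 1)) * d \<longleftrightarrow> double_tau \<le> d"
    and "normalized_scalar_curvature A g T p = 1 / (real n * (real n - 1)) * d \<longleftrightarrow> double_tau = d"
    by (simp_all add: pos_le_divide_eq eq_divide_eq mult.commute)
qed

lemma coeff_a_pos:
  assumes "0 < r" "r < real n * (real n - 1)"
  shows "0 < coeff_a n r"
proof -
  have "real n > 1" using dim_ge_2 by simp
  moreover have "(real n)\<^sup>2 - real n - r > 0" using assms(2) by (simp add: power2_eq_square algebra_simps)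
  ultimately show ?thesis using assms(1) by (simp add: coeff_a_def zero_less_mult_iff)
qed

lemma coeff_a_neg:
  assumes "real n * (real n - 1) < r"
  shows "0 < r" "coeff_a n r < 0"
proof -
  have n: "real n > 1" using dim_ge_2 by simp
  then show r: "0 < r" using assms mult_pos_pos[of "real n" "real n - 1"] by linarith
  have "(real n)\<^sup>2 - real n - r < 0" using assms by (simp add: power2_eq_square algebra_simps)
  moreover have "0 < 1 / (real n * r) * (real n - 1) * (real n + r)" using n r by simp
  ultimately show "coeff_a n r < 0" unfolding coeff_a_def by (rule mult_pos_neg[rotated])
qed

lemma delta_bounds:
  assumes r: "0 < r" "r < real n * (real n - 1)"
  shows "double_tau \<le> delta_casorati m A g F gB \<zeta> r p"
    and "Q \<in> hyperplanes A p \<Longrightarrow> coeff_a n r * (INF P\<in>hyperplanes A p. \<C> P) \<le> coeff_a n r * \<C> Q"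
proof -
  note a = coeff_a_pos[OF r]
  \<comment> \<open>\<open>double_tau_le\<close> solved for the Casorati curvature of the
    hyperplane. Since a(r) is positive, this is a common lower bound, giving both the estimate of
    the infimum and the boundedness that \<open>cINF_lower\<close> requires.\<close>
  let ?b = "(double_tau - r * \<C> (tangent_space A p)) / coeff_a n r"
  have b: "?b \<le> \<C> P" if "P \<in> hyperplanes A p" for P
    using double_tau_le[OF r(1) that] a by (simp add: divide_le_eq mult.commute)
  then have "?b \<le> (INF P\<in>hyperplanes A p. \<C> P)"
    by (intro cINF_greatest hyperplanes_nonempty)
  then show "double_tau \<le> delta_casorati m A g F gB \<zeta> r p"
    using a by (simp add: delta_casorati_def card_n divide_le_eq mult.commute)
  have "bdd_below (\<C> ` hyperplanes A p)" using b by (intro bdd_belowI[of _ ?b]) auto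
  then show "coeff_a n r * (INF P\<in>hyperplanes A p. \<C> P) \<le> coeff_a n r * \<C> Q" if "Q \<in> hyperplanes A p"
    using a that by (intro mult_left_mono cINF_lower) auto
qed

lemma delta_hat_bounds:
  assumes r: "real n * (real n - 1) < r"
  shows "double_tau \<le> delta_hat_casorati m A g F gB \<zeta> r p"
    and "Q \<in> hyperplanes A p \<Longrightarrow> coeff_a n r * (SUP P\<in>hyperplanes A p. \<C> P) \<le> coeff_a n r * \<C> Q"
proof -
  note a = coeff_a_neg[OF r]
  \<comment> \<open>Division by the negative a(r) reverses the inequality, so the same quotient is
    now a common upper bound.\<close>
  let ?b = "(double_tau - r * \<C> (tangent_space A p)) / coeff_a n r"
  have b: "\<C> P \<le> ?b" if "P \<in> hyperplanes A p" for P
    using double_tau_le[OF a(1) that] a(2) by (simp add: neg_le_divide_eq mult.commute)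
  then have "(SUP P\<in>hyperplanes A p. \<C> P) \<le> ?b"
    by (intro cSUP_least hyperplanes_nonempty)
  then show "double_tau \<le> delta_hat_casorati m A g F gB \<zeta> r p"
    using a by (simp add: delta_hat_casorati_def card_n neg_le_divide_eq mult.commute)
  have "bdd_above (\<C> ` hyperplanes A p)" using b by (intro bdd_aboveI[of _ ?b]) auto
  then show "coeff_a n r * (SUP P\<in>hyperplanes A p. \<C> P) \<le> coeff_a n r * \<C> Q" if "Q \<in> hyperplanes A p"
    using a that by (intro mult_left_mono_neg cSUP_upper) auto
qed

end

section \<open>The Casorati inequalities on the manifold and their equality cases\<close>

theorem theorem4p4:
  fixes X :: "'m topology"
    and A :: "('m, 'n::finite) chart set"
    and g :: "'m \<Rightarrow> (('m, 'n) chart \<Rightarrow> real ^ 'n) \<Rightarrow> (('m, 'n) chart \<Rightarrow> real ^ 'n) \<Rightarrow> real"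
    and F :: "'m \<Rightarrow> 'v::real_vector set"
    and Fr :: "('m, nat, 'v) local_frame set"
    and gB :: "'m \<Rightarrow> 'v \<Rightarrow> 'v \<Rightarrow> real"
    and \<zeta> :: "'m \<Rightarrow> (('m, 'n) chart \<Rightarrow> real ^ 'n) \<Rightarrow> (('m, 'n) chart \<Rightarrow> real ^ 'n) \<Rightarrow> 'v"
    and T :: "'m \<Rightarrow> (('m, 'n) chart \<Rightarrow> real ^ 'n) \<Rightarrow> (('m, 'n) chart \<Rightarrow> real ^ 'n) \<Rightarrow>
                (('m, 'n) chart \<Rightarrow> real ^ 'n) \<Rightarrow> (('m, 'n) chart \<Rightarrow> real ^ 'n) \<Rightarrow> real"
    and n m :: nat and p :: 'm
  assumes "CARD('n) = n" and "3 \<le> n" and "n \<le> m"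
    and "riemannian_manifold X A g"
    and "riemannian_vector_bundle X A (m - n) F Fr gB"
    and "symmetric_12_tensor_field X A (m - n) F Fr \<zeta>"
    and "curvature_like X A T"
    and gauss: "\<And>V1 V2 V3 V4 q.
       \<lbrakk>vector_field X A V1; vector_field X A V2; vector_field X A V3; vector_field X A V4;
        q \<in> topspace X\<rbrakk> \<Longrightarrow>
       T q (V1 q) (V2 q) (V3 q) (V4 q) =
         gB q (\<zeta> q (V1 q) (V4 q)) (\<zeta> q (V2 q) (V3 q)) -
         gB q (\<zeta> q (V1 q) (V3 q)) (\<zeta> q (V2 q) (V4 q))"
    and "p \<in> topspace X"
  shows "(\<forall>r. 0 < r \<and> r < real n * (real n - 1) \<longrightarrow>
           normalized_scalar_curvature A g T p
             \<le> 1 / (real n * (real n - 1)) * delta_casorati m A g F gB \<zeta> r p) \<and>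
         (\<forall>r. real n * (real n - 1) < r \<longrightarrow>
           normalized_scalar_curvature A g T p
             \<le> 1 / (real n * (real n - 1)) * delta_hat_casorati m A g F gB \<zeta> r p) \<and>
         ((\<exists>P\<in>hyperplanes A p. casorati n m g F gB \<zeta> p P
             = (INF Q\<in>hyperplanes A p. casorati n m g F gB \<zeta> p Q)) \<longrightarrow>
         (\<forall>r. 0 < r \<and> r < real n * (real n - 1) \<longrightarrow>
           (normalized_scalar_curvature A g T p
              = 1 / (real n * (real n - 1)) * delta_casorati m A g F gB \<zeta> r p
            \<longleftrightarrow> has_equality_form m A g F gB \<zeta> r p))) \<and>
         ((\<exists>P\<in>hyperplanes A p. casorati n m g F gB \<zeta> p P
             = (SUP Q\<in>hyperplanes A p. casorati n m g F gB \<zeta> p Q)) \<longrightarrow>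
         (\<forall>r. real n * (real n - 1) < r \<longrightarrow>
           (normalized_scalar_curvature A g T p
              = 1 / (real n * (real n - 1)) * delta_hat_casorati m A g F gB \<zeta> r p
            \<longleftrightarrow> has_equality_form m A g F gB \<zeta> r p)))"
proof -
  interpret manifold X A
    using assms(4) by unfold_locales (simp add: riemannian_manifold_def)
  have basis: "\<exists>B. finite B \<and> independent B \<and> span B = tangent_space A p \<and> card B = n"
    using ex_chart[OF \<open>p \<in> topspace X\<close>] tangent_space_basis assms(1) by blast
  have vb: "smooth_vector_bundle X A (m - n) F Fr"
    using assms(5) by (simp add: riemannian_vector_bundle_def)
  have "p \<in> (\<Union>(U, t)\<in>Fr. U)"
    using vb \<open>p \<in> topspace X\<close> by (simp add: smooth_vector_bundle_def)
  \<comment> \<open>A local frame around \<open>p\<close>, evaluated at \<open>p\<close>, provides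
    the basis of the fibre that \<open>gauss_point\<close> asks for.\<close>
  then obtain U t where Ut: "(U, t) \<in> Fr" "p \<in> U" by auto
  have "\<forall>(U, t)\<in>Fr. \<forall>p\<in>U. inj_on (\<lambda>i. t i p) {..<m - n} \<and>
      independent ((\<lambda>i. t i p) ` {..<m - n}) \<and> span ((\<lambda>i. t i p) ` {..<m - n}) = F p"
    using vb unfolding smooth_vector_bundle_def by fast
  from bspec[OF this Ut(1)] Ut(2)
  have t: "inj_on (\<lambda>i. t i p) {..<m - n}" "independent ((\<lambda>i. t i p) ` {..<m - n})"
    "span ((\<lambda>i. t i p) ` {..<m - n}) = F p"
    by auto
  have gauss_p: "T p x y y x = gB p (\<zeta> p x x) (\<zeta> p y y) - gB p (\<zeta> p x y) (\<zeta> p y x)"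
    if x: "x \<in> tangent_space A p" and y: "y \<in> tangent_space A p" for x y
  proof -
    \<comment> \<open>The Gauss equation is assumed for vector fields, so \<open>x\<close> and
      \<open>y\<close> are extended and it is applied to X', Y', Y', X' at \<open>p\<close>.\<close>
    obtain X' where X': "vector_field X A X'" "X' p = x"
      using ex_vector_field_through[OF \<open>p \<in> topspace X\<close> x] .
    obtain Y' where Y': "vector_field X A Y'" "Y' p = y"
      using ex_vector_field_through[OF \<open>p \<in> topspace X\<close> y] .
    show ?thesis
      using gauss[OF X'(1) Y'(1) Y'(1) X'(1) \<open>p \<in> topspace X\<close>] X'(2) Y'(2) by simp
  qed
  interpret gauss_point A p g F gB \<zeta> T n m
  proof unfold_locales
    show "subspace (tangent_space A p)" by (rule subspace_tangent_space)
    show "inner_product_on (tangent_space A p) (g p)"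
      using assms(4) \<open>p \<in> topspace X\<close> by (simp add: riemannian_manifold_def smooth_metric_def)
    show "subspace (F p)"
      using assms(5) \<open>p \<in> topspace X\<close> by (simp add: riemannian_vector_bundle_def smooth_vector_bundle_def)
    show "inner_product_on (F p) (gB p)"
      using assms(5) \<open>p \<in> topspace X\<close> by (simp add: riemannian_vector_bundle_def smooth_metric_def)
    show "symmetric_bilinear_on (tangent_space A p) (\<zeta> p)"
      using assms(6) \<open>p \<in> topspace X\<close> by (simp add: symmetric_12_tensor_field_def)
    show "\<zeta> p x y \<in> F p" if "x \<in> tangent_space A p" "y \<in> tangent_space A p" for x y
      using assms(6) \<open>p \<in> topspace X\<close> that by (simp add: symmetric_12_tensor_field_def)
    show "\<exists>B. finite B \<and> independent B \<and> span B = F p \<and> card B = m - n"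
      using t card_image[OF t(1)] by (intro exI[of _ "(\<lambda>i. t i p) ` {..<m - n}"]) simp
  qed (use assms(1-3) basis gauss_p in auto)
  show ?thesis
  \<comment> \<open>The four claims are grouped by the range of r: each block proves the inequality,
    then its equality case for a hyperplane \<open>P\<close> attaining the extremum.\<close>
  proof (intro conjI allI impI; (elim bexE conjE)?)
    fix r :: real assume r: "0 < r" "r < real n * (real n - 1)"
    note bounds = delta_bounds[OF r]
    show "normalized_scalar_curvature A g T p
        \<le> 1 / (real n * (real n - 1)) * delta_casorati m A g F gB \<zeta> r p"
      unfolding normalized_le_iff by (rule bounds)
    fix P assume "P \<in> hyperplanes A p" "casorati n m g F gB \<zeta> p P
        = (INF Q\<in>hyperplanes A p. casorati n m g F gB \<zeta> p Q)"
    from equality_iff[OF r(1) bounds(1)[unfolded delta_casorati_def card_n] bounds(2) this]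
    show "normalized_scalar_curvature A g T p
        = 1 / (real n * (real n - 1)) * delta_casorati m A g F gB \<zeta> r p
        \<longleftrightarrow> has_equality_form m A g F gB \<zeta> r p"
      unfolding normalized_eq_iff delta_casorati_def card_n .
  next
    fix r :: real assume r: "real n * (real n - 1) < r"
    note bounds = delta_hat_bounds[OF r]
    show "normalized_scalar_curvature A g T p
        \<le> 1 / (real n * (real n - 1)) * delta_hat_casorati m A g F gB \<zeta> r p"
      unfolding normalized_le_iff by (rule bounds)
    fix P assume "P \<in> hyperplanes A p" "casorati n m g F gB \<zeta> p P
        = (SUP Q\<in>hyperplanes A p. casorati n m g F gB \<zeta> p Q)"
    from equality_iff[OF coeff_a_neg(1)[OF r] bounds(1)[unfolded delta_hat_casorati_def card_n] bounds(2) this]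
    show "normalized_scalar_curvature A g T p
        = 1 / (real n * (real n - 1)) * delta_hat_casorati m A g F gB \<zeta> r p
        \<longleftrightarrow> has_equality_form m A g F gB \<zeta> r p"
      unfolding normalized_eq_iff delta_hat_casorati_def card_n .
  qed
qed

end
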